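(* Let $(k,\,')$ be a differential field with $\mathrm{char}(k)\neq 2$, let $\alpha,\beta\in k^\times$, let $Q=(\alpha,\beta)_k$ be the corresponding quaternion algebra over $k$, and let $d$ be a derivation on $Q$ extending $'$. Then $(Q,d)$ is split by a differential field extension of $(k,\,')$ of transcendence degree at most $3$ over $k$.
   Context: A derivation on a ring $R$ is an additive map $d$ with $d(xy)=xd(y)+d(x)y$; a differential field $(k,\,')$ is a field with a derivation $'$, and a differential field extension is a field extension with a derivation restricting to the given one. $(\alpha,\beta)_k$ is the quaternion algebra generated over $k$ by $u,v$ with $u^2=\alpha$, $v^2=\beta$, $vu=-uv$. $(Q,d)$ is split by a differential field extension $(L,\,')$ of $(k,\,')$ if there is an $L$-algebra isomorphism $\phi:Q\otimes_kL\to M_2(L)$ with $\phi\circ d^*=\,'\circ\phi$, where $d^*=d\otimes \mathrm{id}_L+\mathrm{id}_Q\otimes\,'$ and $'$ on $M_2(L)$ is the coordinate-wise derivation $(a_{ij})'=(a_{ij}')$. *)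

theory Defs
  imports
    "HOL-Algebra.Generated_Fields"
    "HOL-Algebra.Algebraic_Closure_Type"
    "HOL-Library.Multiset"
begin

section \<open>Derivations and differential fields\<close>

definition derivation :: "('a, 'm) ring_scheme \<Rightarrow> ('a \<Rightarrow> 'a) \<Rightarrow> bool" where
  "derivation R d \<longleftrightarrow>
     d \<in> carrier R \<rightarrow> carrier R \<and>
     (\<forall>x\<in>carrier R. \<forall>y\<in>carrier R. d (x \<oplus>\<^bsub>R\<^esub> y) = d x \<oplus>\<^bsub>R\<^esub> d y) \<and>
     (\<forall>x\<in>carrier R. \<forall>y\<in>carrier R. d (x \<otimes>\<^bsub>R\<^esub> y) = (x \<otimes>\<^bsub>R\<^esub> d y) \<oplus>\<^bsub>R\<^esub> (d x \<otimes>\<^bsub>R\<^esub> y))"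

definition differential_field :: "('a, 'm) ring_scheme \<Rightarrow> ('a \<Rightarrow> 'a) \<Rightarrow> bool" where
  "differential_field K D \<longleftrightarrow> field K \<and> derivation K D"

text \<open>A field extension is given by its structure map \<open>\<iota>\<close>, a unital ring homomorphism between
  fields and hence injective; this allows \<open>K\<close> and \<open>L\<close> to live on different types.\<close>

definition differential_field_extension ::
  "('a, 'm) ring_scheme \<Rightarrow> ('a \<Rightarrow> 'a) \<Rightarrow> ('b, 'n) ring_scheme \<Rightarrow> ('b \<Rightarrow> 'b) \<Rightarrow> ('a \<Rightarrow> 'b) \<Rightarrow> bool"
where
  "differential_field_extension K D L E \<iota> \<longleftrightarrow>
     differential_field K D \<and> differential_field L E \<and> \<iota> \<in> ring_hom K L \<and>
     (\<forall>a\<in>carrier K. E (\<iota> a) = \<iota> (D a))"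


section \<open>Transcendence degree\<close>

text \<open>A monomial in the elements of \<open>S\<close> is a finite multiset \<open>m\<close> over \<open>S\<close>. The elements of \<open>S\<close> are
  algebraically independent over the subfield \<open>F\<close> if no nonzero polynomial over \<open>F\<close> in variables
  indexed by \<open>S\<close>, i.e. no nonzero finite \<open>F\<close>-linear combination of distinct monomials, vanishes.\<close>

definition monomial_value :: "('b, 'n) ring_scheme \<Rightarrow> 'b multiset \<Rightarrow> 'b" where
  "monomial_value L m = (\<Otimes>\<^bsub>L\<^esub>x\<in>set_mset m. x [^]\<^bsub>L\<^esub> count m x)"

definition algebraically_independent :: "('b, 'n) ring_scheme \<Rightarrow> 'b set \<Rightarrow> 'b set \<Rightarrow> bool" where
  "algebraically_independent L F S \<longleftrightarrow>
     (\<forall>M c. finite M \<longrightarrow> (\<forall>m\<in>M. set_mset m \<subseteq> S) \<longrightarrow> c \<in> M \<rightarrow> F \<longrightarrow>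
        (\<Oplus>\<^bsub>L\<^esub>m\<in>M. c m \<otimes>\<^bsub>L\<^esub> monomial_value L m) = \<zero>\<^bsub>L\<^esub> \<longrightarrow>
        (\<forall>m\<in>M. c m = \<zero>\<^bsub>L\<^esub>))"

definition transcendence_basis :: "('b, 'n) ring_scheme \<Rightarrow> 'b set \<Rightarrow> 'b set \<Rightarrow> bool" where
  "transcendence_basis L F S \<longleftrightarrow>
     S \<subseteq> carrier L \<and> algebraically_independent L F S \<and>
     (\<forall>x\<in>carrier L. ring.algebraic L (generate_field L (F \<union> S)) x)"

definition transcendence_degree_le :: "('b, 'n) ring_scheme \<Rightarrow> 'b set \<Rightarrow> nat \<Rightarrow> bool" where
  "transcendence_degree_le L F n \<longleftrightarrow>
     (\<exists>S. transcendence_basis L F S \<and> finite S \<and> card S \<le> n)"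


section \<open>Quaternion algebras\<close>

text \<open>\<open>(x0, x1, x2, x3)\<close> stands for \<open>x0 + x1 u + x2 v + x3 uv\<close>. The multiplication table is forced by
  \<open>u\<^sup>2 = \<alpha>\<close>, \<open>v\<^sup>2 = \<beta>\<close>, \<open>vu = -uv\<close>: e.g. \<open>(uv)\<^sup>2 = -\<alpha>\<beta>\<close>, \<open>u(uv) = \<alpha>v = -(uv)u\<close>,
  \<open>(uv)v = \<beta>u = -v(uv)\<close>.\<close>

definition quaternion_algebra ::
  "('a, 'm) ring_scheme \<Rightarrow> 'a \<Rightarrow> 'a \<Rightarrow> ('a \<times> 'a \<times> 'a \<times> 'a) ring"
where
  "quaternion_algebra K \<alpha> \<beta> =
    \<lparr>carrier = carrier K \<times> carrier K \<times> carrier K \<times> carrier K,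
     monoid.mult = (\<lambda>(x0, x1, x2, x3) (y0, y1, y2, y3).
       (x0 \<otimes>\<^bsub>K\<^esub> y0 \<oplus>\<^bsub>K\<^esub> \<alpha> \<otimes>\<^bsub>K\<^esub> (x1 \<otimes>\<^bsub>K\<^esub> y1) \<oplus>\<^bsub>K\<^esub> \<beta> \<otimes>\<^bsub>K\<^esub> (x2 \<otimes>\<^bsub>K\<^esub> y2)
          \<ominus>\<^bsub>K\<^esub> \<alpha> \<otimes>\<^bsub>K\<^esub> \<beta> \<otimes>\<^bsub>K\<^esub> (x3 \<otimes>\<^bsub>K\<^esub> y3),
        x0 \<otimes>\<^bsub>K\<^esub> y1 \<oplus>\<^bsub>K\<^esub> x1 \<otimes>\<^bsub>K\<^esub> y0 \<oplus>\<^bsub>K\<^esub> \<beta> \<otimes>\<^bsub>K\<^esub> (x3 \<otimes>\<^bsub>K\<^esub> y2) \<ominus>\<^bsub>K\<^esub> \<beta> \<otimes>\<^bsub>K\<^esub> (x2 \<otimes>\<^bsub>K\<^esub> y3),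
        x0 \<otimes>\<^bsub>K\<^esub> y2 \<oplus>\<^bsub>K\<^esub> x2 \<otimes>\<^bsub>K\<^esub> y0 \<oplus>\<^bsub>K\<^esub> \<alpha> \<otimes>\<^bsub>K\<^esub> (x1 \<otimes>\<^bsub>K\<^esub> y3) \<ominus>\<^bsub>K\<^esub> \<alpha> \<otimes>\<^bsub>K\<^esub> (x3 \<otimes>\<^bsub>K\<^esub> y1),
        x0 \<otimes>\<^bsub>K\<^esub> y3 \<oplus>\<^bsub>K\<^esub> x3 \<otimes>\<^bsub>K\<^esub> y0 \<oplus>\<^bsub>K\<^esub> x1 \<otimes>\<^bsub>K\<^esub> y2 \<ominus>\<^bsub>K\<^esub> x2 \<otimes>\<^bsub>K\<^esub> y1)),
     one = (\<one>\<^bsub>K\<^esub>, \<zero>\<^bsub>K\<^esub>, \<zero>\<^bsub>K\<^esub>, \<zero>\<^bsub>K\<^esub>),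
     ring.zero = (\<zero>\<^bsub>K\<^esub>, \<zero>\<^bsub>K\<^esub>, \<zero>\<^bsub>K\<^esub>, \<zero>\<^bsub>K\<^esub>),
     add = (\<lambda>(x0, x1, x2, x3) (y0, y1, y2, y3).
       (x0 \<oplus>\<^bsub>K\<^esub> y0, x1 \<oplus>\<^bsub>K\<^esub> y1, x2 \<oplus>\<^bsub>K\<^esub> y2, x3 \<oplus>\<^bsub>K\<^esub> y3))\<rparr>"

definition quaternion_const :: "('a, 'm) ring_scheme \<Rightarrow> 'a \<Rightarrow> 'a \<times> 'a \<times> 'a \<times> 'a" where
  "quaternion_const K a = (a, \<zero>\<^bsub>K\<^esub>, \<zero>\<^bsub>K\<^esub>, \<zero>\<^bsub>K\<^esub>)"

definition quaternion_u :: "('a, 'm) ring_scheme \<Rightarrow> 'a \<times> 'a \<times> 'a \<times> 'a" where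
  "quaternion_u K = (\<zero>\<^bsub>K\<^esub>, \<one>\<^bsub>K\<^esub>, \<zero>\<^bsub>K\<^esub>, \<zero>\<^bsub>K\<^esub>)"

definition quaternion_v :: "('a, 'm) ring_scheme \<Rightarrow> 'a \<times> 'a \<times> 'a \<times> 'a" where
  "quaternion_v K = (\<zero>\<^bsub>K\<^esub>, \<zero>\<^bsub>K\<^esub>, \<one>\<^bsub>K\<^esub>, \<zero>\<^bsub>K\<^esub>)"

lemma ring_quaternion_algebra:
  fixes \<alpha> \<beta> :: "'k::field"
  shows "ring (quaternion_algebra ring_of_type_algebra \<alpha> \<beta>)"
proof -
  let ?K = "ring_of_type_algebra :: 'k ring"
  interpret K: field ?K by (rule field_from_type_algebra)
  have [simp]: "\<ominus>\<^bsub>?K\<^esub> x = - x" for x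
    by (rule K.minus_equality) (simp_all add: ring_of_type_algebra_def)
  have [simp]: "x \<ominus>\<^bsub>?K\<^esub> y = x - y" for x y
    by (simp add: a_minus_def) (simp add: ring_of_type_algebra_def)
  have [simp]: "carrier ?K = UNIV" "x \<oplus>\<^bsub>?K\<^esub> y = x + y" "x \<otimes>\<^bsub>?K\<^esub> y = x * y" "\<one>\<^bsub>?K\<^esub> = 1" "\<zero>\<^bsub>?K\<^esub> = 0"
    for x y by (simp_all add: ring_of_type_algebra_def)
  let ?Q = "quaternion_algebra ?K \<alpha> \<beta>"
  show ?thesis
  proof (rule ringI)
    show "abelian_group ?Q"
    proof (rule abelian_groupI)
      fix x assume "x \<in> carrier ?Q"
      obtain a b c e where "x = (a, b, c, e)" by (cases x)
      then show "\<exists>y\<in>carrier ?Q. y \<oplus>\<^bsub>?Q\<^esub> x = \<zero>\<^bsub>?Q\<^esub>"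
        by (intro bexI[of _ "(-a, -b, -c, -e)"]) (simp_all add: quaternion_algebra_def)
    qed (auto simp: quaternion_algebra_def)
    show "monoid ?Q"
      by (rule monoidI) (auto simp: quaternion_algebra_def algebra_simps)
  qed (auto simp: quaternion_algebra_def algebra_simps)
qed

lemma quaternion_relations:
  fixes \<alpha> \<beta> :: "'k::field"
  defines "K \<equiv> ring_of_type_algebra" and "Q \<equiv> quaternion_algebra ring_of_type_algebra \<alpha> \<beta>"
  shows "quaternion_u K \<otimes>\<^bsub>Q\<^esub> quaternion_u K = quaternion_const K \<alpha>"
    and "quaternion_v K \<otimes>\<^bsub>Q\<^esub> quaternion_v K = quaternion_const K \<beta>"
    and "quaternion_v K \<otimes>\<^bsub>Q\<^esub> quaternion_u K = \<ominus>\<^bsub>Q\<^esub> (quaternion_u K \<otimes>\<^bsub>Q\<^esub> quaternion_v K)"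
    and "(x0, x1, x2, x3) =
           quaternion_const K x0 \<oplus>\<^bsub>Q\<^esub> quaternion_const K x1 \<otimes>\<^bsub>Q\<^esub> quaternion_u K
           \<oplus>\<^bsub>Q\<^esub> quaternion_const K x2 \<otimes>\<^bsub>Q\<^esub> quaternion_v K
           \<oplus>\<^bsub>Q\<^esub> quaternion_const K x3 \<otimes>\<^bsub>Q\<^esub> (quaternion_u K \<otimes>\<^bsub>Q\<^esub> quaternion_v K)"
    and "quaternion_const K \<in> ring_hom K Q"
proof -
  interpret K: field K unfolding K_def by (rule field_from_type_algebra)
  interpret Q: ring Q unfolding Q_def by (rule ring_quaternion_algebra)
  have [simp]: "\<ominus>\<^bsub>K\<^esub> x = - x" for x
    by (rule K.minus_equality) (simp_all add: K_def ring_of_type_algebra_def)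
  have [simp]: "x \<ominus>\<^bsub>K\<^esub> y = x - y" for x y
    by (simp add: a_minus_def) (simp add: K_def ring_of_type_algebra_def)
  have [simp]: "carrier K = UNIV" "x \<oplus>\<^bsub>K\<^esub> y = x + y" "x \<otimes>\<^bsub>K\<^esub> y = x * y" "\<one>\<^bsub>K\<^esub> = 1" "\<zero>\<^bsub>K\<^esub> = 0"
    for x y by (simp_all add: K_def ring_of_type_algebra_def)
  note defs = Q_def[folded K_def] quaternion_algebra_def quaternion_const_def quaternion_u_def
    quaternion_v_def
  show "quaternion_u K \<otimes>\<^bsub>Q\<^esub> quaternion_u K = quaternion_const K \<alpha>"
    and "quaternion_v K \<otimes>\<^bsub>Q\<^esub> quaternion_v K = quaternion_const K \<beta>"
    and "(x0, x1, x2, x3) =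
           quaternion_const K x0 \<oplus>\<^bsub>Q\<^esub> quaternion_const K x1 \<otimes>\<^bsub>Q\<^esub> quaternion_u K
           \<oplus>\<^bsub>Q\<^esub> quaternion_const K x2 \<otimes>\<^bsub>Q\<^esub> quaternion_v K
           \<oplus>\<^bsub>Q\<^esub> quaternion_const K x3 \<otimes>\<^bsub>Q\<^esub> (quaternion_u K \<otimes>\<^bsub>Q\<^esub> quaternion_v K)"
    and "quaternion_const K \<in> ring_hom K Q"
    by (auto simp: defs ring_hom_def)
  show "quaternion_v K \<otimes>\<^bsub>Q\<^esub> quaternion_u K = \<ominus>\<^bsub>Q\<^esub> (quaternion_u K \<otimes>\<^bsub>Q\<^esub> quaternion_v K)"
    by (rule Q.minus_equality[symmetric]) (simp_all add: defs)
qed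


section \<open>Tensor products of algebras\<close>

text \<open>\<open>A\<close> and \<open>B\<close> are algebras over \<open>K\<close> with structure maps \<open>\<eta>\<close> and \<open>\<theta>\<close> (with central image). The
  multiset \<open>{#(a\<^sub>1, b\<^sub>1), \<dots>, (a\<^sub>n, b\<^sub>n)#}\<close> represents \<open>a\<^sub>1 \<otimes> b\<^sub>1 + \<dots> + a\<^sub>n \<otimes> b\<^sub>n\<close>, and \<open>tensor_eq\<close> is the
  congruence on the free commutative monoid over \<open>A \<times> B\<close> generated by the bilinearity relations.
  Since \<open>a \<otimes> b + (-a) \<otimes> b = 0 \<otimes> b = 0\<close>, the quotient is a group, hence the same as the usual
  quotient of the free abelian group.\<close>

inductive tensor_eq ::
  "('k, 'p) ring_scheme \<Rightarrow> ('a, 'm) ring_scheme \<Rightarrow> ('k \<Rightarrow> 'a) \<Rightarrow> ('b, 'n) ring_scheme \<Rightarrow> ('k \<Rightarrow> 'b) \<Rightarrow>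
     ('a \<times> 'b) multiset \<Rightarrow> ('a \<times> 'b) multiset \<Rightarrow> bool"
  for K A \<eta> B \<theta>
where
  refl: "set_mset M \<subseteq> carrier A \<times> carrier B \<Longrightarrow> tensor_eq K A \<eta> B \<theta> M M"
| sym: "tensor_eq K A \<eta> B \<theta> M N \<Longrightarrow> tensor_eq K A \<eta> B \<theta> N M"
| trans: "tensor_eq K A \<eta> B \<theta> M N \<Longrightarrow> tensor_eq K A \<eta> B \<theta> N P \<Longrightarrow> tensor_eq K A \<eta> B \<theta> M P"
| add: "tensor_eq K A \<eta> B \<theta> M N \<Longrightarrow> tensor_eq K A \<eta> B \<theta> M' N' \<Longrightarrow>
     tensor_eq K A \<eta> B \<theta> (M + M') (N + N')"
| zero_left: "b \<in> carrier B \<Longrightarrow> tensor_eq K A \<eta> B \<theta> {#(\<zero>\<^bsub>A\<^esub>, b)#} {#}"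
| zero_right: "a \<in> carrier A \<Longrightarrow> tensor_eq K A \<eta> B \<theta> {#(a, \<zero>\<^bsub>B\<^esub>)#} {#}"
| add_left: "a \<in> carrier A \<Longrightarrow> a' \<in> carrier A \<Longrightarrow> b \<in> carrier B \<Longrightarrow>
     tensor_eq K A \<eta> B \<theta> {#(a \<oplus>\<^bsub>A\<^esub> a', b)#} {#(a, b), (a', b)#}"
| add_right: "a \<in> carrier A \<Longrightarrow> b \<in> carrier B \<Longrightarrow> b' \<in> carrier B \<Longrightarrow>
     tensor_eq K A \<eta> B \<theta> {#(a, b \<oplus>\<^bsub>B\<^esub> b')#} {#(a, b), (a, b')#}"
| balanced: "a \<in> carrier A \<Longrightarrow> b \<in> carrier B \<Longrightarrow> c \<in> carrier K \<Longrightarrow>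
     tensor_eq K A \<eta> B \<theta> {#(a \<otimes>\<^bsub>A\<^esub> \<eta> c, b)#} {#(a, \<theta> c \<otimes>\<^bsub>B\<^esub> b)#}"

definition tensor_rel ::
  "('k, 'p) ring_scheme \<Rightarrow> ('a, 'm) ring_scheme \<Rightarrow> ('k \<Rightarrow> 'a) \<Rightarrow> ('b, 'n) ring_scheme \<Rightarrow> ('k \<Rightarrow> 'b) \<Rightarrow>
     (('a \<times> 'b) multiset \<times> ('a \<times> 'b) multiset) set"
where
  "tensor_rel K A \<eta> B \<theta> = {(M, N). tensor_eq K A \<eta> B \<theta> M N}"

lemma tensor_eq_carrier:
  assumes "tensor_eq K A \<eta> B \<theta> M N" "ring A" "ring B" "\<eta> \<in> ring_hom K A" "\<theta> \<in> ring_hom K B"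
  shows "set_mset M \<subseteq> carrier A \<times> carrier B \<and> set_mset N \<subseteq> carrier A \<times> carrier B"
proof -
  interpret A: ring A by fact
  interpret B: ring B by fact
  show ?thesis
    using assms(1) by induction (auto simp: ring_hom_closed[OF assms(4)] ring_hom_closed[OF assms(5)])
qed

lemma equiv_tensor_rel:
  assumes "ring A" "ring B" "\<eta> \<in> ring_hom K A" "\<theta> \<in> ring_hom K B"
  shows "equiv {M. set_mset M \<subseteq> carrier A \<times> carrier B} (tensor_rel K A \<eta> B \<theta>)"
  using tensor_eq_carrier[OF _ assms]
  by (intro equivI refl_onI symI transI)
     (auto simp: tensor_rel_def intro: tensor_eq.refl tensor_eq.sym tensor_eq.trans)

definition tensor_class ::
  "('k, 'p) ring_scheme \<Rightarrow> ('a, 'm) ring_scheme \<Rightarrow> ('k \<Rightarrow> 'a) \<Rightarrow> ('b, 'n) ring_scheme \<Rightarrow> ('k \<Rightarrow> 'b) \<Rightarrow>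
     ('a \<times> 'b) multiset \<Rightarrow> ('a \<times> 'b) multiset set"
where
  "tensor_class K A \<eta> B \<theta> M = tensor_rel K A \<eta> B \<theta> `` {M}"

definition tensor_product ::
  "('k, 'p) ring_scheme \<Rightarrow> ('a, 'm) ring_scheme \<Rightarrow> ('k \<Rightarrow> 'a) \<Rightarrow> ('b, 'n) ring_scheme \<Rightarrow> ('k \<Rightarrow> 'b) \<Rightarrow>
     ('a \<times> 'b) multiset set ring"
where
  "tensor_product K A \<eta> B \<theta> =
    \<lparr>carrier = {M. set_mset M \<subseteq> carrier A \<times> carrier B} // tensor_rel K A \<eta> B \<theta>,
     monoid.mult = (\<lambda>S T. \<Union>M\<in>S. \<Union>N\<in>T. tensor_class K A \<eta> B \<theta>
       (\<Sum>(a, b)\<in>#M. {#(a \<otimes>\<^bsub>A\<^esub> a', b \<otimes>\<^bsub>B\<^esub> b'). (a', b') \<in># N#})),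
     one = tensor_class K A \<eta> B \<theta> {#(\<one>\<^bsub>A\<^esub>, \<one>\<^bsub>B\<^esub>)#},
     ring.zero = tensor_class K A \<eta> B \<theta> {#},
     add = (\<lambda>S T. \<Union>M\<in>S. \<Union>N\<in>T. tensor_class K A \<eta> B \<theta> (M + N))\<rparr>"

text \<open>\<open>d \<otimes> id + id \<otimes> E\<close>, which is well defined on classes when \<open>d\<close> and \<open>E\<close> are derivations extending
  the same derivation of \<open>K\<close>.\<close>

definition tensor_derivation ::
  "('k, 'p) ring_scheme \<Rightarrow> ('a, 'm) ring_scheme \<Rightarrow> ('k \<Rightarrow> 'a) \<Rightarrow> ('b, 'n) ring_scheme \<Rightarrow> ('k \<Rightarrow> 'b) \<Rightarrow>
     ('a \<Rightarrow> 'a) \<Rightarrow> ('b \<Rightarrow> 'b) \<Rightarrow> ('a \<times> 'b) multiset set \<Rightarrow> ('a \<times> 'b) multiset set"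
where
  "tensor_derivation K A \<eta> B \<theta> d E S =
     (\<Union>M\<in>S. tensor_class K A \<eta> B \<theta> (\<Sum>(a, b)\<in>#M. {#(d a, b), (a, E b)#}))"


section \<open>Matrix rings\<close>

definition matrix_ring :: "nat \<Rightarrow> ('b, 'n) ring_scheme \<Rightarrow> (nat \<times> nat \<Rightarrow> 'b) ring" where
  "matrix_ring n L =
    \<lparr>carrier = {..<n} \<times> {..<n} \<rightarrow>\<^sub>E carrier L,
     monoid.mult = (\<lambda>A B. \<lambda>(i, j)\<in>{..<n} \<times> {..<n}. \<Oplus>\<^bsub>L\<^esub>k\<in>{..<n}. A (i, k) \<otimes>\<^bsub>L\<^esub> B (k, j)),
     one = (\<lambda>(i, j)\<in>{..<n} \<times> {..<n}. if i = j then \<one>\<^bsub>L\<^esub> else \<zero>\<^bsub>L\<^esub>),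
     ring.zero = (\<lambda>(i, j)\<in>{..<n} \<times> {..<n}. \<zero>\<^bsub>L\<^esub>),
     add = (\<lambda>A B. \<lambda>(i, j)\<in>{..<n} \<times> {..<n}. A (i, j) \<oplus>\<^bsub>L\<^esub> B (i, j))\<rparr>"

definition scalar_matrix :: "nat \<Rightarrow> ('b, 'n) ring_scheme \<Rightarrow> 'b \<Rightarrow> nat \<times> nat \<Rightarrow> 'b" where
  "scalar_matrix n L l = (\<lambda>(i, j)\<in>{..<n} \<times> {..<n}. if i = j then l else \<zero>\<^bsub>L\<^esub>)"

definition matrix_derivation :: "nat \<Rightarrow> ('b \<Rightarrow> 'b) \<Rightarrow> (nat \<times> nat \<Rightarrow> 'b) \<Rightarrow> nat \<times> nat \<Rightarrow> 'b" where
  "matrix_derivation n E A = (\<lambda>(i, j)\<in>{..<n} \<times> {..<n}. E (A (i, j)))"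


section \<open>Splitting\<close>

text \<open>The \<open>K\<close>-algebra \<open>Q\<close> has structure map \<open>\<eta>\<close>, the extension \<open>L\<close> has structure map \<open>\<iota>\<close> and
  derivation \<open>E\<close>. A ring isomorphism is \<open>L\<close>-linear iff it maps each \<open>1 \<otimes> l\<close> to the scalar matrix of
  \<open>l\<close>.\<close>

definition split_by ::
  "('k, 'p) ring_scheme \<Rightarrow> ('a, 'm) ring_scheme \<Rightarrow> ('k \<Rightarrow> 'a) \<Rightarrow> ('a \<Rightarrow> 'a) \<Rightarrow>
     ('b, 'n) ring_scheme \<Rightarrow> ('k \<Rightarrow> 'b) \<Rightarrow> ('b \<Rightarrow> 'b) \<Rightarrow> bool"
where
  "split_by K Q \<eta> d L \<iota> E \<longleftrightarrow>
     (\<exists>\<phi>. \<phi> \<in> ring_iso (tensor_product K Q \<eta> L \<iota>) (matrix_ring 2 L) \<and>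
       (\<forall>l\<in>carrier L. \<phi> (tensor_class K Q \<eta> L \<iota> {#(\<one>\<^bsub>Q\<^esub>, l)#}) = scalar_matrix 2 L l) \<and>
       (\<forall>t\<in>carrier (tensor_product K Q \<eta> L \<iota>).
          \<phi> (tensor_derivation K Q \<eta> L \<iota> d E t) = matrix_derivation 2 E (\<phi> t)))"

text \<open>HOL cannot quantify existentially over types, so a statement asserting that some extension
  \<open>L\<close> of a field \<open>'k\<close> with transcendence degree at most 3 exists must fix the type of the elements
  of \<open>L\<close>. The type \<open>'k poly poly poly fract alg_closure\<close> is big enough: every such \<open>L\<close> embeds into
  the algebraic closure of \<open>k(x, y, z)\<close>. Only the type is fixed; the carrier and the operations of
  \<open>L\<close> are arbitrary.\<close>

end

theory Submission
  imports Defs "HOL-Library.Product_Plus"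
begin

text \<open>Over a field of characteristic different from 2, every derivation \<open>d\<close> of \<open>Q = (\<alpha>, \<beta>)\<^sub>k\<close> that extends \<open>'\<close> has
  the form \<open>d\<^sub>0 + [\<theta>, \<cdot>]\<close> with a pure quaternion \<open>\<theta>\<close>, where \<open>d\<^sub>0\<close> is the standard derivation given by
  \<open>d\<^sub>0 u = \<alpha>'/(2\<alpha>) u\<close> and \<open>d\<^sub>0 v = \<beta>'/(2\<beta>) v\<close> (\<open>quaternion_derivation_form\<close>).

  The standard derivation is split by adjoining square roots \<open>s\<close>, \<open>r\<close> of \<open>\<alpha>\<close>, \<open>\<beta>\<close>, which costs nothing in
  transcendence degree: for \<open>u \<mapsto> diag(s, -s)\<close>, \<open>v \<mapsto> r [[0, 1], [1, 0]]\<close> the coordinatewise derivation of matrices is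
  \<open>d\<^sub>0\<close> (\<open>quat_matrix_iso\<close>, \<open>quat_matrix_deriv\<close>).

  It remains to remove \<open>\<theta>\<close>. If an invertible quaternion \<open>F\<close> satisfies \<open>d\<^sub>0 F = F \<theta> + \<mu> F\<close> for some scalar \<open>\<mu>\<close>, then
  conjugation by \<open>F\<close> carries \<open>d\<close> to \<open>d\<^sub>0\<close> (\<open>qderiv_conjugate\<close>). Because of the freedom in \<open>\<mu>\<close>, one can look for
  \<open>F\<close> of the form \<open>1 + x u + y v + z uv\<close>. The first coordinate of the equation then determines \<open>\<mu>\<close>, and the other
  three express \<open>x'\<close>, \<open>y'\<close>, \<open>z'\<close> as quadratic polynomials in \<open>x\<close>, \<open>y\<close>, \<open>z\<close> over \<open>k\<close>. Taking \<open>x\<close>, \<open>y\<close>, \<open>z\<close> to be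
  independent variables, these formulas define a derivation of \<open>k[x, y, z]\<close> (\<open>derivation_along_poly3\<close>), which
  extends to \<open>k(x, y, z)\<close> and then to \<open>L = k(x, y, z)(s, r)\<close> (\<open>differential_subfield_fractions\<close>, \<open>adjoin_sqrt\<close>).
  The variables form a transcendence basis of \<open>L\<close> over \<open>k\<close>, whence the bound 3. The quaternion \<open>F\<close> is invertible since its norm is a
  polynomial with constant term 1.

  In terms of the definition of splitting, the isomorphism is the composition of the coordinate map
  \<open>Q \<otimes> L \<cong> (\<alpha>, \<beta>)\<^sub>L\<close> (\<open>coords_iso\<close>), conjugation by \<open>F\<close>, and the matrix representation
  (\<open>split_by_conjugation\<close>).\<close>

section \<open>Derivations of polynomial rings\<close>

definition unital_hom :: "('r::comm_ring_1 \<Rightarrow> 's::comm_ring_1) \<Rightarrow> bool" where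
  "unital_hom e \<longleftrightarrow> e 1 = 1 \<and> (\<forall>x y. e (x + y) = e x + e y) \<and> (\<forall>x y. e (x * y) = e x * e y)"

text \<open>A derivation of \<open>R\<close> with values in an \<open>R\<close>-algebra \<open>S\<close> with structure map \<open>e\<close>. Source and target are
  kept apart because the derivative of \<open>x\<close> used below is a polynomial in all three variables, so that the
  subring \<open>k[x]\<close> of \<open>k[x, y, z]\<close> is mapped out of itself.\<close>

definition derivation_along :: "('r::comm_ring_1 \<Rightarrow> 's::comm_ring_1) \<Rightarrow> ('r \<Rightarrow> 's) \<Rightarrow> bool" where
  "derivation_along e \<delta> \<longleftrightarrow>
     (\<forall>x y. \<delta> (x + y) = \<delta> x + \<delta> y) \<and> (\<forall>x y. \<delta> (x * y) = e x * \<delta> y + \<delta> x * e y)"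

lemma unital_hom_zero: "unital_hom e \<Longrightarrow> e 0 = 0"
  unfolding unital_hom_def by (metis add_cancel_left_left add_0)

lemma unital_hom_simps:
  assumes "unital_hom e"
  shows "e 1 = 1" "e 0 = 0" "e (x + y) = e x + e y" "e (x * y) = e x * e y" "e (- x) = - e x"
    "e (x - y) = e x - e y"
proof -
  show add: "e 1 = 1" "e (x + y) = e x + e y" "e (x * y) = e x * e y" for x y
    using assms by (auto simp: unital_hom_def)
  show 0: "e 0 = 0" using assms by (rule unital_hom_zero)
  show m: "e (- x) = - e x" for x using add(2)[of x "- x"] by (simp add: 0 add_eq_0_iff)
  show "e (x - y) = e x - e y" using add(2)[of x "- y"] by (simp add: m)
qed

lemma unital_hom_pCons:
  assumes "unital_hom e"
  shows "e (pCons a p) = e [:a:] + e [:0, 1:] * e p"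
proof -
  have "pCons a p = [:a:] + [:0, 1:] * p" by simp
  then show ?thesis using assms unfolding unital_hom_def by metis
qed

lemma derivation_along_zero: "derivation_along e \<delta> \<Longrightarrow> \<delta> 0 = 0"
  unfolding derivation_along_def by (metis add_cancel_left_left add_0)

text \<open>The value on the variable can be prescribed freely: \<open>p\<close> is sent to the polynomial obtained by applying
  \<open>\<delta>\<close> to the coefficients, plus \<open>g\<close> times the formal derivative, both evaluated at the image of the variable.
  The first summand is called \<open>T\<close> in the proof, and it satisfies the Leibniz rule by itself.\<close>

lemma derivation_along_poly:
  fixes e :: "'r::idom poly \<Rightarrow> 's::comm_ring_1"
  assumes e: "unital_hom e" and \<delta>: "derivation_along (\<lambda>a. e [:a:]) \<delta>"
  obtains \<delta>' where "derivation_along e \<delta>'" "\<And>a. \<delta>' [:a:] = \<delta> a" "\<delta>' [:0, 1:] = g"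
proof -
  have e1: "e 1 = 1" and eadd: "e (x + y) = e x + e y" and emult: "e (x * y) = e x * e y" for x y
    using e by (auto simp: unital_hom_def)
  have \<delta>add: "\<delta> (x + y) = \<delta> x + \<delta> y" and \<delta>mult: "\<delta> (x * y) = e [:x:] * \<delta> y + \<delta> x * e [:y:]" for x y
    using \<delta> by (auto simp: derivation_along_def)
  note \<delta>0 = derivation_along_zero[OF \<delta>] and e0 = unital_hom_zero[OF e] and eC = unital_hom_pCons[OF e]
  define T where "T p = poly (map_poly \<delta> p) (e [:0, 1:])" for p
  have TC: "T (pCons a p) = \<delta> a + e [:0, 1:] * T p" for a p
    by (simp add: T_def map_poly_pCons \<delta>0)
  have T0: "T 0 = 0" by (simp add: T_def)
  have Tadd: "T (p + q) = T p + T q" for p q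
  proof (induction p arbitrary: q)
    case 0 then show ?case by (simp add: T0)
  next
    case (pCons a p)
    show ?case by (cases q) (simp add: TC pCons.IH \<delta>add distrib_left)
  qed
  have Tsmult: "T (smult a q) = e [:a:] * T q + \<delta> a * e q" for a q
  proof (induction q)
    case 0 then show ?case by (simp add: T0 e0)
  next
    case (pCons b q)
    show ?case by (simp add: TC pCons.IH \<delta>mult eC[of b q] algebra_simps)
  qed
  have Tmult: "T (p * q) = e p * T q + T p * e q" for p q
  proof (induction p)
    case 0 then show ?case by (simp add: T0 e0)
  next
    case (pCons a p)
    show ?case by (simp add: Tadd Tsmult TC pCons.IH \<delta>0 eC[of a p] algebra_simps)
  qed
  define \<delta>' where "\<delta>' p = T p + e (pderiv p) * g" for p
  show ?thesis
  proof
    show "derivation_along e \<delta>'"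
      by (auto simp: derivation_along_def \<delta>'_def Tadd Tmult pderiv_add pderiv_mult eadd emult algebra_simps)
    show "\<delta>' [:a:] = \<delta> a" for a by (simp add: \<delta>'_def TC T0 pderiv_pCons e0)
    have "\<delta> 1 = 0" using \<delta>mult[of 1 1] e1 by (simp flip: one_pCons)
    then have "T [:0, 1:] = 0" by (simp add: TC T0 \<delta>0)
    then show "\<delta>' [:0, 1:] = g" by (simp add: \<delta>'_def pderiv_pCons e1 flip: one_pCons)
  qed
qed

text \<open>The variables are adjoined one at a time, always with values in \<open>k[x, y, z]\<close>; only after the last step
  do source and target agree.\<close>

lemma derivation_along_poly3:
  fixes D :: "'k::idom \<Rightarrow> 'k" and g1 g2 g3 :: "'k poly poly poly"
  assumes "derivation_along id D"
  obtains \<delta> where "derivation_along id \<delta>" "\<And>a. \<delta> [:[:[:a:]:]:] = [:[:[:D a:]:]:]"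
    "\<delta> [:[:[:0, 1:]:]:] = g1" "\<delta> [:[:0, 1:]:] = g2" "\<delta> [:0, 1:] = g3"
proof -
  have D0: "derivation_along (\<lambda>a. [:[:[:a:]:]:]) (\<lambda>a. [:[:[:D a:]:]:])"
    using assms by (simp add: derivation_along_def)
  have "unital_hom (\<lambda>p::'k poly. [:[:p:]:])" by (simp add: unital_hom_def one_pCons)
  from derivation_along_poly[OF this, of _ g1, OF D0] obtain D1 where
    D1: "derivation_along (\<lambda>p. [:[:p:]:]) D1" "\<And>a. D1 [:a:] = [:[:[:D a:]:]:]" "D1 [:0, 1:] = g1" by blast
  have "unital_hom (\<lambda>p::'k poly poly. [:p:])" by (simp add: unital_hom_def one_pCons)
  from derivation_along_poly[OF this, of _ g2, OF D1(1)] obtain D2 where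
    D2: "derivation_along (\<lambda>p. [:p:]) D2" "\<And>a. D2 [:a:] = D1 a" "D2 [:0, 1:] = g2" by blast
  have "unital_hom (id :: 'k poly poly poly \<Rightarrow> _)" by (simp add: unital_hom_def)
  from derivation_along_poly[OF this, of D2 g3] D2(1) obtain D3 where
    D3: "derivation_along id D3" "\<And>a. D3 [:a:] = D2 a" "D3 [:0, 1:] = g3" by auto
  show ?thesis by (rule that[OF D3(1)]) (simp_all add: D3 D2 D1)
qed

section \<open>Differential fields of fractions and square roots\<close>

text \<open>Differential fields inside a fixed ambient field. The ambient field itself need not carry an extension of
  the derivation: an algebraic closure in positive characteristic is in general not separable.\<close>

locale differential_subfield =
  fixes C :: "'a::field set" and E :: "'a \<Rightarrow> 'a"
  assumes one_mem: "1 \<in> C"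
    and minus_mem: "x \<in> C \<Longrightarrow> y \<in> C \<Longrightarrow> x - y \<in> C"
    and mult_mem: "x \<in> C \<Longrightarrow> y \<in> C \<Longrightarrow> x * y \<in> C"
    and inverse_mem: "x \<in> C \<Longrightarrow> inverse x \<in> C"
    and deriv_mem: "x \<in> C \<Longrightarrow> E x \<in> C"
    and deriv_add: "x \<in> C \<Longrightarrow> y \<in> C \<Longrightarrow> E (x + y) = E x + E y"
    and deriv_mult: "x \<in> C \<Longrightarrow> y \<in> C \<Longrightarrow> E (x * y) = x * E y + E x * y"
begin

lemma zero_mem: "0 \<in> C"
  using minus_mem[OF one_mem one_mem] by simp

lemma uminus_mem: "x \<in> C \<Longrightarrow> - x \<in> C"
  using minus_mem[OF zero_mem, of x] by simp

lemma add_mem: "x \<in> C \<Longrightarrow> y \<in> C \<Longrightarrow> x + y \<in> C"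
  using minus_mem[of x "- y"] uminus_mem by simp

lemma divide_mem: "x \<in> C \<Longrightarrow> y \<in> C \<Longrightarrow> x / y \<in> C"
  by (simp add: divide_inverse mult_mem inverse_mem)

lemma two_mem: "2 \<in> C"
  using add_mem[OF one_mem one_mem] by simp

lemmas mem = zero_mem one_mem two_mem minus_mem uminus_mem add_mem mult_mem divide_mem deriv_mem

lemma deriv_zero: "E 0 = 0"
  by (metis add_cancel_left_left add_0 deriv_add zero_mem)

lemma deriv_one: "E 1 = 0"
  by (metis add_cancel_left_left deriv_mult mult_1 mult_1_right one_mem)

lemma deriv_uminus: "x \<in> C \<Longrightarrow> E (- x) = - E x"
  using deriv_add[of x "- x"] uminus_mem by (simp add: deriv_zero add_eq_0_iff)

lemma deriv_diff: "x \<in> C \<Longrightarrow> y \<in> C \<Longrightarrow> E (x - y) = E x - E y"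
  using deriv_add[of x "- y"] uminus_mem by (simp add: deriv_uminus)

lemmas deriv = deriv_zero deriv_add deriv_uminus deriv_diff deriv_mult

end

text \<open>The quotient rule is additive and satisfies the Leibniz rule. Here \<open>a\<close>, \<open>b\<close>, \<open>a'\<close>, \<open>b'\<close> stand for the derivatives
  of \<open>P\<close>, \<open>Q\<close>, \<open>P'\<close>, \<open>Q'\<close>.\<close>

lemma quotient_rule_add:
  fixes P Q P' Q' a b a' b' :: "'a::field"
  assumes "Q \<noteq> 0" "Q' \<noteq> 0"
  shows "((P * b' + a * Q' + (P' * b + a' * Q)) * (Q * Q') - (P * Q' + P' * Q) * (Q * b' + b * Q')) / (Q * Q')\<^sup>2
    = (a * Q - P * b) / Q\<^sup>2 + (a' * Q' - P' * b') / Q'\<^sup>2"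
proof -
  have "(a * Q - P * b) / Q\<^sup>2 + (a' * Q' - P' * b') / Q'\<^sup>2 =
    ((a * Q - P * b) * Q'\<^sup>2 + (a' * Q' - P' * b') * Q\<^sup>2) / (Q * Q')\<^sup>2"
    using assms by (simp add: add_frac_eq power_mult_distrib)
  also have "(a * Q - P * b) * Q'\<^sup>2 + (a' * Q' - P' * b') * Q\<^sup>2 =
    (P * b' + a * Q' + (P' * b + a' * Q)) * (Q * Q') - (P * Q' + P' * Q) * (Q * b' + b * Q')"
    by Groebner_Basis.algebra
  finally show ?thesis by simp
qed

lemma quotient_rule_mult:
  fixes P Q P' Q' a b a' b' :: "'a::field"
  assumes "Q \<noteq> 0" "Q' \<noteq> 0"
  shows "((P * a' + a * P') * (Q * Q') - P * P' * (Q * b' + b * Q')) / (Q * Q')\<^sup>2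
    = P / Q * ((a' * Q' - P' * b') / Q'\<^sup>2) + (a * Q - P * b) / Q\<^sup>2 * (P' / Q')"
proof -
  have "P / Q * ((a' * Q' - P' * b') / Q'\<^sup>2) = P * Q * (a' * Q' - P' * b') / (Q * Q')\<^sup>2"
    using assms by (simp add: power2_eq_square)
  moreover have "(a * Q - P * b) / Q\<^sup>2 * (P' / Q') = (a * Q - P * b) * (P' * Q') / (Q * Q')\<^sup>2"
    using assms by (simp add: power2_eq_square)
  ultimately have "P / Q * ((a' * Q' - P' * b') / Q'\<^sup>2) + (a * Q - P * b) / Q\<^sup>2 * (P' / Q') =
    (P * Q * (a' * Q' - P' * b') + (a * Q - P * b) * (P' * Q')) / (Q * Q')\<^sup>2"
    by (simp only: add_divide_distrib)
  also have "P * Q * (a' * Q' - P' * b') + (a * Q - P * b) * (P' * Q') =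
    (P * a' + a * P') * (Q * Q') - P * P' * (Q * b' + b * Q')"
    by Groebner_Basis.algebra
  finally show ?thesis by simp
qed

text \<open>A derivation of a domain extends to its field of fractions by the quotient rule. The relation \<open>R\<close> in the
  proof is the graph of the extension; that it is single valued follows from differentiating
  \<open>p q' = p' q\<close>.\<close>

lemma differential_subfield_fractions:
  fixes e :: "'r::idom \<Rightarrow> 'a::field"
  assumes e: "unital_hom e" and inj: "\<And>x. e x = 0 \<Longrightarrow> x = 0" and \<delta>: "derivation_along id \<delta>"
  obtains E where "differential_subfield {e p / e q |p q. q \<noteq> 0} E" "\<And>p. E (e p) = e (\<delta> p)"
proof -
  let ?C = "{e p / e q |p q. q \<noteq> 0}"
  have e1: "e 1 = 1" and eadd: "e (x + y) = e x + e y" and emult: "e (x * y) = e x * e y" for x y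
    using e by (auto simp: unital_hom_def)
  note e0 = unital_hom_zero[OF e] and edf = unital_hom_simps(6)[OF e]
  have einj: "e x = e y \<longleftrightarrow> x = y" for x y using inj[of "x - y"] by (auto simp: edf)
  have enz: "e x = 0 \<longleftrightarrow> x = 0" for x using inj e0 by auto
  have \<delta>add: "\<delta> (x + y) = \<delta> x + \<delta> y" and \<delta>mult: "\<delta> (x * y) = x * \<delta> y + \<delta> x * y" for x y
    using \<delta> by (auto simp: derivation_along_def)
  define R where "R x f \<longleftrightarrow> (\<exists>p q. q \<noteq> 0 \<and> x = e p / e q \<and> f = (e (\<delta> p) * e q - e p * e (\<delta> q)) / (e q)\<^sup>2)" for x f
  have R_unique: "f = f'" if "R x f" "R x f'" for x f f'
  proof -
    obtain p q where 1: "q \<noteq> 0" "x = e p / e q" "f = (e (\<delta> p) * e q - e p * e (\<delta> q)) / (e q)\<^sup>2"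
      using \<open>R x f\<close> unfolding R_def by blast
    obtain p' q' where 2: "q' \<noteq> 0" "x = e p' / e q'"
      "f' = (e (\<delta> p') * e q' - e p' * e (\<delta> q')) / (e q')\<^sup>2"
      using \<open>R x f'\<close> unfolding R_def by blast
    note * = 1 2
    have nz: "e q \<noteq> 0" "e q' \<noteq> 0" using * enz by auto
    have "e (p * q') = e (p' * q)" using * nz by (simp add: emult frac_eq_eq)
    then have pq: "p * q' = p' * q" by (simp add: einj)
    have "e (\<delta> (p * q')) = e (\<delta> (p' * q))" by (simp only: pq)
    then have d: "e p * e (\<delta> q') + e (\<delta> p) * e q' = e p' * e (\<delta> q) + e (\<delta> p') * e q"
      by (simp add: \<delta>mult eadd emult)
    have p: "e p * e q' = e p' * e q" using arg_cong[OF pq, of e] by (simp add: emult)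
    have cross: "(a * Q - P * b) * Q'\<^sup>2 = (a' * Q' - P' * b') * Q\<^sup>2"
      if "P * Q' = P' * Q" "P * b' + a * Q' = P' * b + a' * Q" for P Q P' Q' a b a' b' :: 'a
      using that by Groebner_Basis.algebra
    have "(e (\<delta> p) * e q - e p * e (\<delta> q)) * (e q')\<^sup>2 = (e (\<delta> p') * e q' - e p' * e (\<delta> q')) * (e q)\<^sup>2"
      using p d by (rule cross)
    then show ?thesis unfolding * using nz by (simp add: frac_eq_eq)
  qed
  define E where "E x = (THE f. R x f)" for x
  have E: "E x = f" if "R x f" for x f
    unfolding E_def by (rule the_equality) (use that R_unique in blast)+
  have Ef: "E (e p / e q) = (e (\<delta> p) * e q - e p * e (\<delta> q)) / (e q)\<^sup>2" if "q \<noteq> 0" for p q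
    by (rule E) (use that in \<open>auto simp: R_def\<close>)
  show ?thesis
  proof
    show "differential_subfield ?C E"
    proof
      show "1 \<in> ?C" by (rule CollectI, rule exI[of _ 1], rule exI[of _ 1]) (simp add: e1)
    next
      fix x y assume "x \<in> ?C" "y \<in> ?C"
      then obtain p q p' q' where *: "q \<noteq> 0" "q' \<noteq> 0" "x = e p / e q" "y = e p' / e q'" by blast
      have nz: "e q \<noteq> 0" "e q' \<noteq> 0" using * enz by auto
      have nz': "q * q' \<noteq> 0" using * by simp
      have "x - y = e (p * q' - p' * q) / e (q * q')" using * nz by (simp add: emult edf diff_frac_eq)
      then show "x - y \<in> ?C" using nz' by blast
      have m: "x * y = e (p * p') / e (q * q')" using * by (simp add: emult)
      then show "x * y \<in> ?C" using nz' by blast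
      have a: "x + y = e (p * q' + p' * q) / e (q * q')" using * nz by (simp add: emult eadd add_frac_eq)
      show "E (x + y) = E x + E y"
        unfolding a Ef[OF nz'] unfolding * Ef[OF *(1)] Ef[OF *(2)] eadd emult \<delta>add \<delta>mult
        by (rule quotient_rule_add[OF nz])
      show "E (x * y) = x * E y + E x * y"
        unfolding m Ef[OF nz'] unfolding * Ef[OF *(1)] Ef[OF *(2)] eadd emult \<delta>add \<delta>mult
        by (rule quotient_rule_mult[OF nz])
    next
      fix x assume "x \<in> ?C"
      then obtain p q where *: "q \<noteq> 0" "x = e p / e q" by blast
      have "E x = e (\<delta> p * q - p * \<delta> q) / e (q * q)"
        by (simp add: * Ef emult edf power2_eq_square)
      then show "E x \<in> ?C" using * by (metis (mono_tags, lifting) CollectI mult_eq_0_iff)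
      show "inverse x \<in> ?C"
      proof (cases "p = 0")
        case True then have "inverse x = e 0 / e 1" by (simp add: * e0)
        then show ?thesis using one_neq_zero by blast
      next
        case False
        have "inverse x = e q / e p" by (simp add: *)
        then show ?thesis using False by blast
      qed
    qed
    have "\<delta> 1 = 0" by (metis \<delta>mult add_cancel_left_left mult_1 mult_1_right)
    then show "E (e p) = e (\<delta> p)" for p using Ef[of 1 p] by (simp add: e1 e0)
  qed
qed

text \<open>Differentiating \<open>s\<^sup>2\<close> forces the derivative of \<open>s\<close> to be \<open>c s\<close> with \<open>c = (s\<^sup>2)' / (2 s\<^sup>2)\<close>, and this choice works
  because \<open>1\<close>, \<open>s\<close> is a basis of the extension unless \<open>s\<close> already lies in \<open>C\<close>. This step needs
  characteristic different from 2.\<close>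

lemma (in differential_subfield) adjoin_sqrt:
  assumes two: "(2::'a) \<noteq> 0" and s2: "s\<^sup>2 \<in> C" and s0: "s \<noteq> 0"
  obtains E' where "differential_subfield {a + b * s |a b. a \<in> C \<and> b \<in> C} E'"
    "\<And>x. x \<in> C \<Longrightarrow> E' x = E x"
proof (cases "s \<in> C")
  case True
  have "a \<in> {a + b * s |a b. a \<in> C \<and> b \<in> C}" if "a \<in> C" for a
    using that zero_mem by force
  then have "{a + b * s |a b. a \<in> C \<and> b \<in> C} = C"
    using True by (auto simp: mem)
  then show ?thesis using that[of E] differential_subfield_axioms by simp
next
  case False
  let ?C = "{a + b * s |a b. a \<in> C \<and> b \<in> C}"
  have uniq: "a = a' \<and> b = b'"
    if "a + b * s = a' + b' * s" "a \<in> C" "b \<in> C" "a' \<in> C" "b' \<in> C" for a b a' b'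
  proof -
    have *: "(b - b') * s = a' - a" using that(1) by (simp add: algebra_simps)
    have "b = b'"
    proof (rule ccontr)
      assume "b \<noteq> b'"
      then have "s = (a' - a) / (b - b')" using * by (simp add: field_simps)
      then show False using False that by (auto simp: mem)
    qed
    then show ?thesis using that by simp
  qed
  define c where "c = E (s\<^sup>2) / (2 * s\<^sup>2)"
  have c: "c \<in> C" by (simp add: c_def s2 mem)
  have cs: "E (s\<^sup>2) = 2 * c * s\<^sup>2" using two s0 by (simp add: c_def)
  define E' where "E' x = (THE f. \<exists>a\<in>C. \<exists>b\<in>C. x = a + b * s \<and> f = E a + (E b + c * b) * s)" for x
  have E': "E' (a + b * s) = E a + (E b + c * b) * s" if "a \<in> C" "b \<in> C" for a b
    unfolding E'_def
  proof (rule the_equality)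
    fix f assume "\<exists>a'\<in>C. \<exists>b'\<in>C. a + b * s = a' + b' * s \<and> f = E a' + (E b' + c * b') * s"
    then show "f = E a + (E b + c * b) * s" using uniq that by metis
  qed (use that in blast)
  have I: "a + b * s \<in> ?C" if "a \<in> C" "b \<in> C" for a b using that by blast
  show ?thesis
  proof
    show "E' x = E x" if "x \<in> C" for x
      using E'[OF that zero_mem] by (simp add: deriv_zero)
    show "differential_subfield ?C E'"
    proof
      show "1 \<in> ?C" using I[OF one_mem zero_mem] by simp
    next
      fix x y assume "x \<in> ?C" "y \<in> ?C"
      then obtain a b a' b' where *: "a \<in> C" "b \<in> C" "a' \<in> C" "b' \<in> C" "x = a + b * s" "y = a' + b' * s"
        by blast
      have "x - y = (a - a') + (b - b') * s" by (simp add: * algebra_simps)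
      then show "x - y \<in> ?C" using I[OF minus_mem[OF *(1,3)] minus_mem[OF *(2,4)]] by simp
      have "x + y = (a + a') + (b + b') * s" by (simp add: * algebra_simps)
      then show "E' (x + y) = E' x + E' y"
        using E'[of "a + a'" "b + b'"] by (simp add: * E' mem deriv algebra_simps)
      have m: "x * y = (a * a' + b * b' * s\<^sup>2) + (a * b' + a' * b) * s"
        by (simp add: * algebra_simps power2_eq_square)
      then show "x * y \<in> ?C" using I[of "a * a' + b * b' * s\<^sup>2" "a * b' + a' * b"] * s2 by (simp add: mem)
      have "E' (x * y) = E (a * a' + b * b' * s\<^sup>2) + (E (a * b' + a' * b) + c * (a * b' + a' * b)) * s"
        unfolding m by (rule E') (use * s2 in \<open>auto simp: mem\<close>)
      also have "\<dots> = x * E' y + E' x * y"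
        by (simp add: * E' s2 mem deriv cs) (simp add: algebra_simps power2_eq_square)
      finally show "E' (x * y) = x * E' y + E' x * y" .
    next
      fix x assume "x \<in> ?C"
      then obtain a b where *: "a \<in> C" "b \<in> C" "x = a + b * s" by blast
      show "E' x \<in> ?C" unfolding *(3) E'[OF *(1,2)] using * c by (intro I) (auto simp: mem)
      show "inverse x \<in> ?C"
      proof (cases "x = 0")
        case True then show ?thesis using I[OF zero_mem zero_mem] by simp
      next
        case F: False
        define n where "n = a * a - b * b * s\<^sup>2"
        have n: "n = x * (a + (- b) * s)" by (simp add: n_def * algebra_simps power2_eq_square)
        have "a + (- b) * s \<noteq> 0 + 0 * s"
        proof
          assume "a + (- b) * s = 0 + 0 * s"
          then have "a = 0 \<and> - b = 0" by (rule uniq) (use * in \<open>auto simp: mem\<close>)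
          then show False using F * by simp
        qed
        then have "n \<noteq> 0" using F n by simp
        have "x * ((a + (- b) * s) / n) = 1" using \<open>n \<noteq> 0\<close> n by simp
        then have "inverse x = (a + (- b) * s) / n" by (rule inverse_unique)
        then have "inverse x = a / n + (- b / n) * s" by (simp add: diff_divide_distrib)
        moreover have "n \<in> C" unfolding n_def using * s2 by (simp add: mem)
        ultimately show ?thesis using I[of "a / n" "- b / n"] * by (simp add: mem)
      qed
    qed
  qed
qed

section \<open>Quaternions in coordinates\<close>

type_synonym 'a quat = "'a \<times> 'a \<times> 'a \<times> 'a"

fun qmul :: "'a::field \<Rightarrow> 'a \<Rightarrow> 'a quat \<Rightarrow> 'a quat \<Rightarrow> 'a quat" where
  "qmul a b (x0, x1, x2, x3) (y0, y1, y2, y3) =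
     (x0 * y0 + a * (x1 * y1) + b * (x2 * y2) - a * b * (x3 * y3),
      x0 * y1 + x1 * y0 + b * (x3 * y2) - b * (x2 * y3),
      x0 * y2 + x2 * y0 + a * (x1 * y3) - a * (x3 * y1),
      x0 * y3 + x3 * y0 + x1 * y2 - x2 * y1)"

fun qscale :: "'a::field \<Rightarrow> 'a quat \<Rightarrow> 'a quat" where
  "qscale l (x0, x1, x2, x3) = (l * x0, l * x1, l * x2, l * x3)"

abbreviation qone :: "'a::field quat" where "qone \<equiv> (1, 0, 0, 0)"

lemma quat_zero: "(0::'a::field quat) = (0, 0, 0, 0)"
  by (simp add: zero_prod_def)

lemma qmul_assoc: "qmul a b (qmul a b x y) z = qmul a b x (qmul a b y z)"
  by (cases x; cases y; cases z) (simp add: algebra_simps)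

lemma qmul_add_left: "qmul a b (x + y) z = qmul a b x z + qmul a b y z"
  and qmul_add_right: "qmul a b x (y + z) = qmul a b x y + qmul a b x z"
  by (cases x; cases y; cases z; simp add: algebra_simps)+

lemma qmul_minus_right: "qmul a b x (- z) = - qmul a b x z"
  by (cases x; cases z) (simp add: algebra_simps)

lemma qmul_diff_left: "qmul a b (x - y) z = qmul a b x z - qmul a b y z"
  and qmul_diff_right: "qmul a b x (y - z) = qmul a b x y - qmul a b x z"
  by (cases x; cases y; cases z; simp add: algebra_simps)+

lemma qmul_scale_left: "qmul a b (qscale l x) y = qscale l (qmul a b x y)"
  and qmul_scale_right: "qmul a b x (qscale l y) = qscale l (qmul a b x y)"
  by (cases x; cases y; simp add: algebra_simps)+

lemma qmul_one: "qmul a b qone x = x" "qmul a b x qone = x"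
  by (cases x; simp)+

lemma qmul_zero: "qmul a b 0 x = 0" "qmul a b x 0 = 0"
  by (cases x; simp add: quat_zero)+

lemma qscale_add: "qscale l (x + y) = qscale l x + qscale l y"
  and qscale_scale: "qscale l (qscale l' x) = qscale (l * l') x"
  and qscale_zero: "qscale l 0 = 0" "qscale 0 x = 0"
  by (cases x; cases y; simp add: algebra_simps quat_zero)+

text \<open>The product of a quaternion and its conjugate, in either order, is the norm \<open>N\<close>, a scalar.\<close>

lemma qmul_inverse:
  assumes "F = (x0, x1, x2, x3)" "N = x0\<^sup>2 - a * x1\<^sup>2 - b * x2\<^sup>2 + a * b * x3\<^sup>2" "N \<noteq> 0"
  defines "G \<equiv> qscale (1 / N) (x0, - x1, - x2, - x3)"
  shows "qmul a b F G = qone" "qmul a b G F = qone"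
proof -
  have "qmul a b F (x0, - x1, - x2, - x3) = (N, 0, 0, 0)" "qmul a b (x0, - x1, - x2, - x3) F = (N, 0, 0, 0)"
    by (simp_all add: assms(1,2) algebra_simps power2_eq_square)
  then show "qmul a b F G = qone" "qmul a b G F = qone"
    using assms(3) by (simp_all add: G_def qmul_scale_left qmul_scale_right del: qscale.simps) simp_all
qed

abbreviation quats :: "'a set \<Rightarrow> 'a quat set" where "quats C \<equiv> C \<times> C \<times> C \<times> C"

context differential_subfield
begin

lemma qmul_mem: "a \<in> C \<Longrightarrow> b \<in> C \<Longrightarrow> x \<in> quats C \<Longrightarrow> y \<in> quats C \<Longrightarrow> qmul a b x y \<in> quats C"
  by (cases x; cases y) (auto simp: mem)

lemma qscale_mem: "l \<in> C \<Longrightarrow> x \<in> quats C \<Longrightarrow> qscale l x \<in> quats C"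
  by (cases x) (auto simp: mem)

lemma quat_add_mem: "x \<in> quats C \<Longrightarrow> y \<in> quats C \<Longrightarrow> x + y \<in> quats C"
  by (cases x; cases y) (auto simp: mem)

end

section \<open>The standard derivation and conjugation\<close>

text \<open>The derivation of \<open>(a, b)\<close> that extends \<open>E\<close> and satisfies \<open>u' = c1 u\<close>, \<open>v' = c2 v\<close>. With \<open>c1 = a'/(2a)\<close> and
  \<open>c2 = b'/(2b)\<close> this is compatible with \<open>u\<^sup>2 = a\<close>, \<open>v\<^sup>2 = b\<close>; it is the standard derivation \<open>d\<^sub>0\<close>.\<close>

fun qderiv :: "('a::field \<Rightarrow> 'a) \<Rightarrow> 'a \<Rightarrow> 'a \<Rightarrow> 'a quat \<Rightarrow> 'a quat" where
  "qderiv E c1 c2 (x0, x1, x2, x3) = (E x0, E x1 + c1 * x1, E x2 + c2 * x2, E x3 + (c1 + c2) * x3)"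

locale quaternion_derivation = differential_subfield C E for C :: "'a::field set" and E +
  fixes a b c1 c2 :: 'a
  assumes ab_mem: "a \<in> C" "b \<in> C"
    and deriv_a: "E a = 2 * c1 * a" and deriv_b: "E b = 2 * c2 * b"
begin

lemma qderiv_add: "x \<in> quats C \<Longrightarrow> y \<in> quats C \<Longrightarrow> qderiv E c1 c2 (x + y) = qderiv E c1 c2 x + qderiv E c1 c2 y"
  by (cases x; cases y) (auto simp: deriv algebra_simps)

lemma qderiv_qmul:
  assumes "x \<in> quats C" "y \<in> quats C"
  shows "qderiv E c1 c2 (qmul a b x y) = qmul a b (qderiv E c1 c2 x) y + qmul a b x (qderiv E c1 c2 y)"
proof -
  obtain x0 x1 x2 x3 y0 y1 y2 y3 where xy: "x = (x0, x1, x2, x3)" "y = (y0, y1, y2, y3)"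
    by (cases x; cases y)
  have C: "x0 \<in> C" "x1 \<in> C" "x2 \<in> C" "x3 \<in> C" "y0 \<in> C" "y1 \<in> C" "y2 \<in> C" "y3 \<in> C"
    using assms by (auto simp: xy)
  note d = C mem ab_mem deriv deriv_a deriv_b
  show ?thesis unfolding xy qmul.simps qderiv.simps add_Pair prod.inject
  proof (intro conjI)
    show "E (x0 * y0 + a * (x1 * y1) + b * (x2 * y2) - a * b * (x3 * y3)) =
      E x0 * y0 + a * ((E x1 + c1 * x1) * y1) + b * ((E x2 + c2 * x2) * y2)
        - a * b * ((E x3 + (c1 + c2) * x3) * y3) +
      (x0 * E y0 + a * (x1 * (E y1 + c1 * y1)) + b * (x2 * (E y2 + c2 * y2))
        - a * b * (x3 * (E y3 + (c1 + c2) * y3)))"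
      by (simp only: d, Groebner_Basis.algebra)
  qed (simp only: d, Groebner_Basis.algebra)+
qed

text \<open>Gauge transformation: if \<open>d\<^sub>0 F = F \<theta> + l F\<close> with a scalar \<open>l\<close>, then conjugation by \<open>F\<close> turns
  \<open>d\<^sub>0 + [\<theta>, \<cdot>]\<close> into \<open>d\<^sub>0\<close>. The scalar is harmless since scalars commute with everything; allowing it is what
  makes it possible to normalise the first coordinate of \<open>F\<close> to 1 and so to work with three unknowns
  instead of four. Here \<open>G\<close> is the inverse of \<open>F\<close>.\<close>

lemma qderiv_conjugate:
  assumes FG: "qmul a b F G = qone" "qmul a b G F = qone"
    and F: "F \<in> quats C" and G: "G \<in> quats C" and x: "x \<in> quats C"
    and dF: "qderiv E c1 c2 F = qmul a b F \<theta> + qscale l F"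
  shows "qderiv E c1 c2 (qmul a b (qmul a b F x) G) =
    qmul a b (qmul a b F (qderiv E c1 c2 x + qmul a b \<theta> x - qmul a b x \<theta>)) G"
proof -
  note ass = qmul_assoc and dist = qmul_add_left qmul_add_right
  let ?m = "qmul a b" and ?d = "qderiv E c1 c2"
  have m: "?m u v \<in> quats C" if "u \<in> quats C" "v \<in> quats C" for u v
    by (rule qmul_mem[OF ab_mem that])
  have "?m (?d F) G + ?m F (?d G) = 0"
    using qderiv_qmul[OF F G] by (simp add: FG deriv_zero deriv_one quat_zero)
  then have "?m G (?m (?d F) G) + ?m G (?m F (?d G)) = 0"
    by (simp add: qmul_zero flip: qmul_add_right)
  moreover have "?m G (?m F (?d G)) = ?d G"
    by (simp add: FG qmul_one flip: qmul_assoc)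
  ultimately have "?d G = - ?m G (?m (?d F) G)"
    by (simp add: add_eq_0_iff2)
  also have "?m G (?m (?d F) G) = ?m \<theta> G + qscale l G"
  proof -
    have "?m G (?m (?m F \<theta> + qscale l F) G) = ?m (?m (?m G F) \<theta> + qscale l (?m G F)) G"
      by (simp add: dist qmul_scale_left qmul_scale_right ass)
    then show ?thesis by (simp only: dF FG qmul_one qmul_scale_left qmul_add_left)
  qed
  finally have dG: "?d G = - (?m \<theta> G + qscale l G)" .
  have "?d (?m (?m F x) G) = ?m (?m (?d F) x + ?m F (?d x)) G + ?m (?m F x) (?d G)"
    using F G x m by (simp only: qderiv_qmul)
  also have "\<dots> = ?m (?m F (?d x + ?m \<theta> x - ?m x \<theta>)) G"
    by (simp add: dF dG dist ass qmul_scale_left qmul_scale_right qmul_minus_right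
        qmul_diff_left qmul_diff_right)
  finally show ?thesis .
qed

end

section \<open>Splitting the standard derivation by square roots\<close>

text \<open>A subset of a field type as a ring in the sense of records, which is the form in which the field \<open>L\<close> of the
  theorem is given.\<close>

abbreviation restrict_ring :: "'a::field set \<Rightarrow> 'a ring" where
  "restrict_ring C \<equiv> ring_of_type_algebra\<lparr>carrier := C\<rparr>"

lemma restrict_ring_simps [simp]:
  "carrier (restrict_ring C) = C" "\<one>\<^bsub>restrict_ring C\<^esub> = 1" "\<zero>\<^bsub>restrict_ring C\<^esub> = 0"
  "x \<oplus>\<^bsub>restrict_ring C\<^esub> y = x + y" "x \<otimes>\<^bsub>restrict_ring C\<^esub> y = x * y"
  by (simp_all add: ring_of_type_algebra_def)

lemma type_ring_simps [simp]:
  "carrier (ring_of_type_algebra :: 'a::field ring) = UNIV"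
  "\<one>\<^bsub>ring_of_type_algebra :: 'a::field ring\<^esub> = 1" "\<zero>\<^bsub>ring_of_type_algebra :: 'a::field ring\<^esub> = 0"
  "x \<oplus>\<^bsub>ring_of_type_algebra :: 'a::field ring\<^esub> y = x + y"
  "x \<otimes>\<^bsub>ring_of_type_algebra :: 'a::field ring\<^esub> y = x * y"
  by (simp_all add: ring_of_type_algebra_def)

context differential_subfield
begin

lemma field_restrict_ring: "field (restrict_ring C)"
proof -
  have i: "\<exists>y\<in>C. y * x = 1 \<and> x * y = 1" if "x \<in> C" "x \<noteq> 0" for x
    using that inverse_mem[of x] by (intro bexI[of _ "inverse x"]) auto
  have n: "\<exists>y\<in>C. y + x = 0 \<and> x + y = 0" if "x \<in> C" for x
    using that uminus_mem[of x] by (intro bexI[of _ "- x"]) auto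
  show ?thesis
    by unfold_locales (use i n in \<open>auto simp: mem algebra_simps Units_def\<close>)
qed

lemma differential_field_restrict_ring: "differential_field (restrict_ring C) E"
  unfolding differential_field_def derivation_def
  using field_restrict_ring by (auto simp: mem deriv)

lemma finsum_restrict_ring: "f \<in> A \<rightarrow> C \<Longrightarrow> finsum (restrict_ring C) f A = sum f A"
proof (induction A rule: infinite_finite_induct)
  interpret field "restrict_ring C" by (rule field_restrict_ring)
  {
    case (infinite A)
    then show ?case using finsum_infinite[of A f] by simp
  next
    case empty
    then show ?case by simp
  next
    case (insert x F)
    then show ?case using finsum_insert[of F x f] by auto
  }
qed

end

text \<open>The representation \<open>u \<mapsto> diag(s, -s)\<close>, \<open>v \<mapsto> r [[0, 1], [1, 0]]\<close>. Adjoining both square roots, rather than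
  only one of them, makes the images of \<open>u\<close> and \<open>v\<close> multiples of constant matrices, so that the coordinatewise derivation
  of matrices corresponds to the standard derivation of quaternions.\<close>

fun quat_matrix :: "'a::field \<Rightarrow> 'a \<Rightarrow> 'a quat \<Rightarrow> nat \<times> nat \<Rightarrow> 'a" where
  "quat_matrix s r (x0, x1, x2, x3) = (\<lambda>(i, j)\<in>{..<2} \<times> {..<2}.
     if i = 0 then (if j = 0 then x0 + s * x1 else r * (x2 + s * x3))
     else (if j = 0 then r * (x2 - s * x3) else x0 - s * x1))"

lemma less_two_cases: "i < 2 \<longleftrightarrow> i = 0 \<or> i = (1::nat)" by auto

lemma restrict_two_eqI:
  assumes "\<And>i j. i \<in> {0, 1} \<Longrightarrow> j \<in> {0, 1} \<Longrightarrow> f (i, j) = g (i, j)"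
  shows "restrict f ({..<2::nat} \<times> {..<2::nat}) = restrict g ({..<2} \<times> {..<2})"
  using assms by (intro restrict_ext) (auto simp: less_two_cases)

lemma quat_matrix_mult:
  assumes "differential_subfield C E" "s \<in> C" "r \<in> C" "x \<in> quats C" "y \<in> quats C"
  shows "quat_matrix s r (qmul (s\<^sup>2) (r\<^sup>2) x y) =
    quat_matrix s r x \<otimes>\<^bsub>matrix_ring 2 (restrict_ring C)\<^esub> quat_matrix s r y"
proof -
  interpret differential_subfield C E by fact
  have two: "{..<2::nat} = {0, 1}" by auto
  obtain x0 x1 x2 x3 y0 y1 y2 y3 where xy: "x = (x0, x1, x2, x3)" "y = (y0, y1, y2, y3)"
    by (cases x; cases y)
  have C: "x0 \<in> C" "x1 \<in> C" "x2 \<in> C" "x3 \<in> C" "y0 \<in> C" "y1 \<in> C" "y2 \<in> C" "y3 \<in> C"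
    using assms(4,5) by (auto simp: xy)
  show ?thesis
    unfolding matrix_ring_def monoid.simps xy qmul.simps quat_matrix.simps[of s r "_ + _"]
      quat_matrix.simps[of s r "_ - _"]
    by (rule restrict_two_eqI, (subst split_conv)+, subst finsum_restrict_ring)
      (use C assms(2,3) in \<open>auto simp: mem two algebra_simps power2_eq_square\<close>)
qed

lemma (in differential_subfield) a_minus_restrict_ring:
  assumes "x \<in> C" "y \<in> C"
  shows "x \<ominus>\<^bsub>restrict_ring C\<^esub> y = x - y"
proof -
  interpret R: field "restrict_ring C" by (rule field_restrict_ring)
  have "\<ominus>\<^bsub>restrict_ring C\<^esub> y = - y"
    by (rule R.minus_equality) (use assms in \<open>simp_all add: mem\<close>)
  then show ?thesis by (simp add: a_minus_def)
qed

lemma differential_subfield_UNIV: "differential_subfield UNIV (\<lambda>_. 0)"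
  by unfold_locales auto

lemma restrict_ring_UNIV: "restrict_ring UNIV = ring_of_type_algebra"
  by (simp add: ring_of_type_algebra_def)

lemma a_minus_type_ring [simp]: "x \<ominus>\<^bsub>ring_of_type_algebra :: 'a::field ring\<^esub> y = x - y"
  using differential_subfield.a_minus_restrict_ring[OF differential_subfield_UNIV, of x y]
  by (simp add: restrict_ring_UNIV)

lemma quaternion_algebra_type_simps [simp]:
  fixes a b :: "'a::field"
  defines "Q \<equiv> quaternion_algebra ring_of_type_algebra a b"
  shows "carrier Q = UNIV" "x \<oplus>\<^bsub>Q\<^esub> y = x + y" "x \<otimes>\<^bsub>Q\<^esub> y = qmul a b x y" "\<zero>\<^bsub>Q\<^esub> = 0" "\<one>\<^bsub>Q\<^esub> = qone"
  by (cases x; cases y; simp add: Q_def quaternion_algebra_def quat_zero)+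

lemma (in differential_subfield) quaternion_algebra_simps:
  fixes a b :: 'a
  defines "Q \<equiv> quaternion_algebra (restrict_ring C) a b"
  assumes "a \<in> C" "b \<in> C"
  shows "carrier Q = quats C" "x \<oplus>\<^bsub>Q\<^esub> y = x + y" "\<zero>\<^bsub>Q\<^esub> = 0" "\<one>\<^bsub>Q\<^esub> = qone"
    "x \<in> quats C \<Longrightarrow> y \<in> quats C \<Longrightarrow> x \<otimes>\<^bsub>Q\<^esub> y = qmul a b x y"
  using assms(2,3)
  by (cases x; cases y; auto simp: Q_def quaternion_algebra_def quat_zero a_minus_restrict_ring mem)+

text \<open>Inverting the representation means solving for the four coordinates, which requires dividing by 2.\<close>

lemma (in differential_subfield) quat_matrix_bij:
  assumes two: "(2::'a) \<noteq> 0" and s: "s \<in> C" "s \<noteq> 0" and r: "r \<in> C" "r \<noteq> 0"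
  shows "bij_betw (quat_matrix s r) (quats C) ({..<2} \<times> {..<2} \<rightarrow>\<^sub>E C)"
proof (rule bij_betw_byWitness)
  have "(4::'a) = 2 * 2" by simp
  then have four: "(4::'a) \<noteq> 0" using two by (metis mult_eq_0_iff)
  define from_matrix where "from_matrix A = ((A (0, 0) + A (1, 1)) / 2, (A (0, 0) - A (1, 1)) / (2 * s),
    (A (0, 1) + A (1, 0)) / (2 * r), (A (0, 1) - A (1, 0)) / (2 * r * s))"
    for A :: "nat \<times> nat \<Rightarrow> 'a"
  show "\<forall>x\<in>quats C. from_matrix (quat_matrix s r x) = x"
    using two s r by (auto simp: from_matrix_def field_simps)
  show "\<forall>A\<in>{..<2} \<times> {..<2} \<rightarrow>\<^sub>E C. quat_matrix s r (from_matrix A) = A"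
  proof
    fix A assume A: "A \<in> {..<2::nat} \<times> {..<2::nat} \<rightarrow>\<^sub>E C"
    have "quat_matrix s r (from_matrix A) = restrict A ({..<2} \<times> {..<2})"
      unfolding from_matrix_def quat_matrix.simps
      by (rule restrict_two_eqI) (use two four s r in \<open>auto simp: field_simps\<close>)
    also have "\<dots> = A" using A by (rule PiE_restrict)
    finally show "quat_matrix s r (from_matrix A) = A" .
  qed
  show "quat_matrix s r ` quats C \<subseteq> {..<2} \<times> {..<2} \<rightarrow>\<^sub>E C"
    using s r by (auto simp: mem split: if_splits)
  show "from_matrix ` ({..<2} \<times> {..<2} \<rightarrow>\<^sub>E C) \<subseteq> quats C"
  proof (intro image_subsetI)
    fix A assume "A \<in> {..<2::nat} \<times> {..<2::nat} \<rightarrow>\<^sub>E C"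
    then have "A (i, j) \<in> C" if "i < 2" "j < 2" for i j using that by (auto simp: PiE_iff)
    then show "from_matrix A \<in> quats C" using s r by (auto simp: from_matrix_def mem)
  qed
qed

lemma (in differential_subfield) quat_matrix_iso:
  assumes "(2::'a) \<noteq> 0" "s \<in> C" "s \<noteq> 0" "r \<in> C" "r \<noteq> 0"
  shows "quat_matrix s r \<in> ring_iso (quaternion_algebra (restrict_ring C) (s\<^sup>2) (r\<^sup>2)) (matrix_ring 2 (restrict_ring C))"
proof -
  have sq: "s\<^sup>2 \<in> C" "r\<^sup>2 \<in> C" using assms by (simp_all add: power2_eq_square mem)
  note Q = quaternion_algebra_simps[OF sq]
  have M: "carrier (matrix_ring 2 (restrict_ring C)) = {..<2} \<times> {..<2} \<rightarrow>\<^sub>E C"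
    by (simp add: matrix_ring_def)
  note bij = quat_matrix_bij[OF assms]
  show ?thesis unfolding ring_iso_def
  proof (intro CollectI conjI ring_hom_memI)
    fix x assume x: "x \<in> carrier (quaternion_algebra (restrict_ring C) (s\<^sup>2) (r\<^sup>2))"
    show "quat_matrix s r x \<in> carrier (matrix_ring 2 (restrict_ring C))"
      using bij_betwE[OF bij] x unfolding M Q by blast
    fix y assume y: "y \<in> carrier (quaternion_algebra (restrict_ring C) (s\<^sup>2) (r\<^sup>2))"
    show "quat_matrix s r (x \<otimes>\<^bsub>quaternion_algebra (restrict_ring C) (s\<^sup>2) (r\<^sup>2)\<^esub> y) =
      quat_matrix s r x \<otimes>\<^bsub>matrix_ring 2 (restrict_ring C)\<^esub> quat_matrix s r y"
      using quat_matrix_mult[OF differential_subfield_axioms assms(2,4)] x y by (simp add: Q)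
    show "quat_matrix s r (x \<oplus>\<^bsub>quaternion_algebra (restrict_ring C) (s\<^sup>2) (r\<^sup>2)\<^esub> y) =
      quat_matrix s r x \<oplus>\<^bsub>matrix_ring 2 (restrict_ring C)\<^esub> quat_matrix s r y"
      unfolding Q by (cases x; cases y)
        (auto simp: matrix_ring_def algebra_simps intro!: restrict_two_eqI)
  next
    show "quat_matrix s r \<one>\<^bsub>quaternion_algebra (restrict_ring C) (s\<^sup>2) (r\<^sup>2)\<^esub> = \<one>\<^bsub>matrix_ring 2 (restrict_ring C)\<^esub>"
      unfolding Q by (auto simp: matrix_ring_def intro!: restrict_two_eqI)
    show "bij_betw (quat_matrix s r) (carrier (quaternion_algebra (restrict_ring C) (s\<^sup>2) (r\<^sup>2)))
      (carrier (matrix_ring 2 (restrict_ring C)))"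
      using bij unfolding M Q .
  qed
qed

lemma quat_matrix_scalar: "quat_matrix s r (l, 0, 0, 0) = scalar_matrix 2 (restrict_ring C) l"
  unfolding quat_matrix.simps scalar_matrix_def by (rule restrict_two_eqI) auto

text \<open>The hypotheses on \<open>E s\<close> and \<open>E r\<close> are what \<open>u' = c1 u\<close> and \<open>v' = c2 v\<close> become for the matrix entries.\<close>

lemma (in differential_subfield) quat_matrix_deriv:
  assumes s: "s \<in> C" "E s = c1 * s" and r: "r \<in> C" "E r = c2 * r" and x: "x \<in> quats C"
  shows "quat_matrix s r (qderiv E c1 c2 x) = matrix_derivation 2 E (quat_matrix s r x)"
proof -
  obtain x0 x1 x2 x3 where xx: "x = (x0, x1, x2, x3)" by (cases x)
  then have C: "x0 \<in> C" "x1 \<in> C" "x2 \<in> C" "x3 \<in> C" using x by auto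
  show ?thesis
    unfolding xx qderiv.simps quat_matrix.simps matrix_derivation_def
    by (rule restrict_two_eqI) (use C s r in \<open>auto simp: mem deriv algebra_simps\<close>)
qed

lemma (in differential_subfield) conjugation_iso:
  assumes ab: "a \<in> C" "b \<in> C" and F: "F \<in> quats C" and G: "G \<in> quats C"
    and FG: "qmul a b F G = qone" "qmul a b G F = qone"
  shows "(\<lambda>x. qmul a b (qmul a b F x) G) \<in>
    ring_iso (quaternion_algebra (restrict_ring C) a b) (quaternion_algebra (restrict_ring C) a b)"
proof -
  note Q = quaternion_algebra_simps[OF ab]
  note m = qmul_mem[OF ab]
  have FG': "qmul a b F (qmul a b G x) = x" "qmul a b G (qmul a b F x) = x" for x
    by (simp_all add: FG qmul_one flip: qmul_assoc)
  show ?thesis unfolding ring_iso_def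
  proof (intro CollectI conjI ring_hom_memI)
    show "bij_betw (\<lambda>x. qmul a b (qmul a b F x) G) (carrier (quaternion_algebra (restrict_ring C) a b))
      (carrier (quaternion_algebra (restrict_ring C) a b))"
      unfolding Q
      by (rule bij_betw_byWitness[where f' = "\<lambda>x. qmul a b (qmul a b G x) F"])
         (intro ballI image_subsetI m F G, (simp_all only: qmul_assoc FG FG' qmul_one))+
  qed (simp_all only: Q m F G qmul_add_left qmul_add_right qmul_assoc FG FG' qmul_one)
qed

section \<open>Quaternions over an extension field as a tensor product\<close>

fun qmap :: "('a \<Rightarrow> 'b) \<Rightarrow> 'a quat \<Rightarrow> 'b quat" where
  "qmap f (x0, x1, x2, x3) = (f x0, f x1, f x2, f x3)"

text \<open>The coordinates of a formal sum of tensors under \<open>(\<alpha>, \<beta>)\<^sub>k \<otimes> L \<cong> (\<alpha>, \<beta>)\<^sub>L\<close>, \<open>q \<otimes> l \<mapsto> l q\<close>. They are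
  defined on representatives; the lemmas below show that they classify the tensor product.\<close>

definition tensor_coords :: "('k::field \<Rightarrow> 'a::field) \<Rightarrow> ('k quat \<times> 'a) multiset \<Rightarrow> 'a quat" where
  "tensor_coords \<iota> M = (\<Sum>(q, l)\<in>#M. qscale l (qmap \<iota> q))"

lemma tensor_coords_simps [simp]:
  "tensor_coords \<iota> {#} = 0"
  "tensor_coords \<iota> (add_mset (q, l) M) = qscale l (qmap \<iota> q) + tensor_coords \<iota> M"
  "tensor_coords \<iota> (M + N) = tensor_coords \<iota> M + tensor_coords \<iota> N"
  by (simp_all add: tensor_coords_def)

locale quaternion_tensor = differential_subfield C E for C :: "'a::field set" and E +
  fixes \<iota> :: "'k::field \<Rightarrow> 'a" and \<alpha> \<beta> :: 'k
  assumes hom: "unital_hom \<iota>" and \<iota>_mem: "\<iota> x \<in> C"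
begin

abbreviation "K \<equiv> ring_of_type_algebra :: 'k ring"
abbreviation "Q \<equiv> quaternion_algebra K \<alpha> \<beta>"
abbreviation "teq \<equiv> tensor_eq K Q (quaternion_const K) (restrict_ring C) \<iota>"
abbreviation "tcl \<equiv> tensor_class K Q (quaternion_const K) (restrict_ring C) \<iota>"
abbreviation "tprod \<equiv> tensor_product K Q (quaternion_const K) (restrict_ring C) \<iota>"
abbreviation "reps \<equiv> {M. set_mset M \<subseteq> UNIV \<times> C}"

lemmas hom_simps = unital_hom_simps[OF hom]

lemma qmap_add: "qmap \<iota> (x + y) = qmap \<iota> x + qmap \<iota> y"
  by (cases x; cases y) (simp add: hom_simps)

lemma qmap_qmul: "qmap \<iota> (qmul \<alpha> \<beta> x y) = qmul (\<iota> \<alpha>) (\<iota> \<beta>) (qmap \<iota> x) (qmap \<iota> y)"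
  by (cases x; cases y) (simp add: hom_simps)

lemma qmap_zero: "qmap \<iota> 0 = 0"
  by (simp add: quat_zero hom_simps)

lemma qmap_mem: "qmap \<iota> q \<in> quats C"
  by (cases q) (simp add: \<iota>_mem)

lemma qscale_add_left: "qscale (l + l') x = qscale l x + qscale l' x" for x :: "'a quat"
  by (cases x) (simp add: algebra_simps)

lemma tensor_coords_cong: "teq M N \<Longrightarrow> tensor_coords \<iota> M = tensor_coords \<iota> N"
proof (induction rule: tensor_eq.induct)
  case (balanced a b c)
  show ?case by (cases a) (simp add: quaternion_const_def hom_simps algebra_simps)
qed (simp_all add: qmap_add qmap_zero qscale_add qscale_add_left qscale_zero)

text \<open>The representative \<open>1 \<otimes> x0 + u \<otimes> x1 + v \<otimes> x2 + uv \<otimes> x3\<close>. Every formal sum is equivalent to the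
  normal form with the same coordinates, so that two formal sums are equivalent as soon as
  their coordinates agree.\<close>

fun normal_form :: "'a quat \<Rightarrow> ('k quat \<times> 'a) multiset" where
  "normal_form (x0, x1, x2, x3) =
    {#((1, 0, 0, 0), x0), ((0, 1, 0, 0), x1), ((0, 0, 1, 0), x2), ((0, 0, 0, 1), x3)#}"

lemma teq_normal_form_zero: "teq {#} (normal_form 0)"
proof -
  have z: "teq {#} {#(q, 0)#}" for q
    using tensor_eq.zero_right[of q Q K "quaternion_const K" "restrict_ring C" \<iota>]
    by (auto intro: tensor_eq.sym)
  have "teq ({#} + ({#} + ({#} + {#}))) ({#((1, 0, 0, 0), 0)#} + ({#((0, 1, 0, 0), 0)#} +
      ({#((0, 0, 1, 0), 0)#} + {#((0, 0, 0, 1), 0)#})))"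
    by (intro tensor_eq.add z)
  then show ?thesis by (simp add: quat_zero add_mset_commute)
qed

lemma teq_normal_form_add:
  assumes "x \<in> quats C" "y \<in> quats C"
  shows "teq (normal_form x + normal_form y) (normal_form (x + y))"
proof -
  obtain x0 x1 x2 x3 y0 y1 y2 y3 where xy: "x = (x0, x1, x2, x3)" "y = (y0, y1, y2, y3)"
    by (cases x, cases y)
  have s: "teq {#(q, l), (q, l')#} {#(q, l + l')#}" if "l \<in> C" "l' \<in> C" for q l l'
    using tensor_eq.add_right[of q Q l "restrict_ring C" l'] that
    by (auto intro: tensor_eq.sym)
  have "teq ({#((1, 0, 0, 0), x0), ((1, 0, 0, 0), y0)#} + ({#((0, 1, 0, 0), x1), ((0, 1, 0, 0), y1)#} +
      ({#((0, 0, 1, 0), x2), ((0, 0, 1, 0), y2)#} + {#((0, 0, 0, 1), x3), ((0, 0, 0, 1), y3)#})))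
    ({#((1, 0, 0, 0), x0 + y0)#} + ({#((0, 1, 0, 0), x1 + y1)#} +
      ({#((0, 0, 1, 0), x2 + y2)#} + {#((0, 0, 0, 1), x3 + y3)#})))"
    using assms by (intro tensor_eq.add s) (auto simp: xy)
  then show ?thesis by (simp add: xy ac_simps add_mset_commute)
qed

lemma teq_normal_form_pure:
  assumes "l \<in> C"
  shows "teq {#(q, l)#} (normal_form (qscale l (qmap \<iota> q)))"
proof -
  obtain q0 q1 q2 q3 where q: "q = (q0, q1, q2, q3)" by (cases q)
  have s: "teq {#(p + p', l)#} (M + M')" if "teq {#(p, l)#} M" "teq {#(p', l)#} M'" for p p' M M'
  proof -
    have "teq {#(p + p', l)#} ({#(p, l)#} + {#(p', l)#})"
      using tensor_eq.add_left[of p Q p' l "restrict_ring C"] assms by (simp add: add_mset_commute)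
    then show ?thesis using tensor_eq.add[OF that] by (rule tensor_eq.trans)
  qed
  have b: "teq {#(qmul \<alpha> \<beta> p (c, 0, 0, 0), l)#} {#(p, l * \<iota> c)#}" for p c
    using tensor_eq.balanced[of p Q l "restrict_ring C" c K "quaternion_const K" \<iota>] assms
    by (simp add: quaternion_const_def mult.commute)
  have "teq {#((q0, 0, 0, 0) + ((0, q1, 0, 0) + ((0, 0, q2, 0) + (0, 0, 0, q3))), l)#}
    ({#((1, 0, 0, 0), l * \<iota> q0)#} + ({#((0, 1, 0, 0), l * \<iota> q1)#} +
      ({#((0, 0, 1, 0), l * \<iota> q2)#} + {#((0, 0, 0, 1), l * \<iota> q3)#})))"
    using b[of "(1, 0, 0, 0)" q0] b[of "(0, 1, 0, 0)" q1] b[of "(0, 0, 1, 0)" q2] b[of "(0, 0, 0, 1)" q3]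
    by (intro s) simp_all
  then show ?thesis by (simp add: q add_mset_commute)
qed

lemma tensor_coords_mem: "M \<in> reps \<Longrightarrow> tensor_coords \<iota> M \<in> quats C"
proof (induction M)
  case empty
  then show ?case by (simp add: quat_zero zero_mem)
next
  case (add p M)
  then show ?case by (cases p) (auto intro!: quat_add_mem qscale_mem qmap_mem simp del: mem_Sigma_iff)
qed

lemma teq_normal_form: "M \<in> reps \<Longrightarrow> teq M (normal_form (tensor_coords \<iota> M))"
proof (induction M)
  case empty
  then show ?case using teq_normal_form_zero by simp
next
  case (add p M)
  obtain q l where p: "p = (q, l)" by (cases p)
  have l: "l \<in> C" and M: "M \<in> reps" using add.prems by (auto simp: p)
  have "teq ({#(q, l)#} + M) (normal_form (qscale l (qmap \<iota> q)) + normal_form (tensor_coords \<iota> M))"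
    by (rule tensor_eq.add[OF teq_normal_form_pure[OF l] add.IH[OF M]])
  from tensor_eq.trans[OF this teq_normal_form_add[OF qscale_mem[OF l qmap_mem] tensor_coords_mem[OF M]]]
  show ?case by (simp add: p)
qed

lemma normal_form_reps: "x \<in> quats C \<Longrightarrow> normal_form x \<in> reps"
  by (cases x) auto

lemma tensor_coords_normal_form: "tensor_coords \<iota> (normal_form x) = x"
  by (cases x) (simp add: hom_simps quat_zero)

lemma tensor_class_eq:
  assumes "M \<in> reps"
  shows "tcl M = {N \<in> reps. tensor_coords \<iota> N = tensor_coords \<iota> M}"
proof -
  have r: "N \<in> reps" if "teq M N" for N
    using tensor_eq_carrier[OF that]
    using ring_quaternion_algebra[of \<alpha> \<beta>] field_restrict_ring quaternion_relations(5)[of \<alpha> \<beta>]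
    by (auto simp: field_def domain_def cring_def ring_hom_def hom_simps \<iota>_mem)
  have "teq M N" if "N \<in> reps" "tensor_coords \<iota> N = tensor_coords \<iota> M" for N
    using teq_normal_form[OF assms] tensor_eq.sym[OF teq_normal_form[OF that(1)]] that(2)
    by (auto intro: tensor_eq.trans)
  then show ?thesis
    using r tensor_coords_cong by (auto simp: tensor_class_def tensor_rel_def)
qed

text \<open>Equivalent representatives have the same coordinates, so the choice does not matter.\<close>

definition coords :: "('k quat \<times> 'a) multiset set \<Rightarrow> 'a quat" where
  "coords S = tensor_coords \<iota> (SOME M. M \<in> S)"

lemma coords_class: "M \<in> reps \<Longrightarrow> coords (tcl M) = tensor_coords \<iota> M"
  unfolding coords_def by (rule someI2[of _ M]) (auto simp: tensor_class_eq)

lemma carrier_tprod: "carrier tprod = tcl ` reps"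
  by (auto simp: tensor_product_def quotient_def tensor_class_def)

lemma tcl_eq_iff: "M \<in> reps \<Longrightarrow> N \<in> reps \<Longrightarrow> tcl M = tcl N \<longleftrightarrow> tensor_coords \<iota> M = tensor_coords \<iota> N"
  by (auto simp: tensor_class_eq)

text \<open>The operations on the tensor product are unions over all representatives. An operation on
  representatives whose coordinates depend only on the coordinates of its argument may be
  evaluated at any one of them.\<close>

lemma UN_tcl:
  assumes "M \<in> reps" "\<And>M'. M' \<in> reps \<Longrightarrow> f M' \<in> reps"
    "\<And>M'. M' \<in> reps \<Longrightarrow> tensor_coords \<iota> M' = tensor_coords \<iota> M \<Longrightarrow> tensor_coords \<iota> (f M') = tensor_coords \<iota> (f M)"
  shows "(\<Union>M'\<in>tcl M. tcl (f M')) = tcl (f M)"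
proof -
  have "tcl (f M') = tcl (f M)" if "M' \<in> tcl M" for M'
  proof -
    have M': "M' \<in> reps" "tensor_coords \<iota> M' = tensor_coords \<iota> M"
      using that unfolding tensor_class_eq[OF assms(1)] by blast+
    show ?thesis
      using assms(2)[OF M'(1)] assms(2)[OF assms(1)] assms(3)[OF M'] by (simp only: tcl_eq_iff)
  qed
  moreover have "M \<in> tcl M" using assms(1) tensor_class_eq[OF assms(1)] by blast
  ultimately show ?thesis by blast
qed

lemma tensor_coords_mult:
  "tensor_coords \<iota> (\<Sum>(a, b)\<in>#M. {#(a \<otimes>\<^bsub>Q\<^esub> a', b \<otimes>\<^bsub>restrict_ring C\<^esub> b'). (a', b') \<in># N#}) =
    qmul (\<iota> \<alpha>) (\<iota> \<beta>) (tensor_coords \<iota> M) (tensor_coords \<iota> N)"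
proof (induction M)
  case empty
  then show ?case by (simp add: qmul_zero)
next
  case (add p M)
  obtain a b where p: "p = (a, b)" by (cases p)
  have "tensor_coords \<iota> {#(qmul \<alpha> \<beta> a a', b * b'). (a', b') \<in># N#} =
    qmul (\<iota> \<alpha>) (\<iota> \<beta>) (qscale b (qmap \<iota> a)) (tensor_coords \<iota> N)"
  proof (induction N)
    case empty
    then show ?case by (simp add: qmul_zero)
  next
    case (add p N)
    then show ?case
      by (cases p) (simp add: qmap_qmul qmul_scale_left qmul_scale_right qmul_add_right qscale_scale mult.commute)
  qed
  then show ?case using add.IH by (simp add: p qmul_add_left)
qed

lemma mult_reps:
  "M \<in> reps \<Longrightarrow> N \<in> reps \<Longrightarrow>
    (\<Sum>(a, b)\<in>#M. {#(a \<otimes>\<^bsub>Q\<^esub> a', b \<otimes>\<^bsub>restrict_ring C\<^esub> b'). (a', b') \<in># N#}) \<in> reps"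
  by (force simp: mult_mem)

lemma tprod_mult:
  assumes "M \<in> reps" "N \<in> reps"
  shows "tcl M \<otimes>\<^bsub>tprod\<^esub> tcl N =
    tcl (\<Sum>(a, b)\<in>#M. {#(a \<otimes>\<^bsub>Q\<^esub> a', b \<otimes>\<^bsub>restrict_ring C\<^esub> b'). (a', b') \<in># N#})"
proof -
  let ?f = "\<lambda>M N. (\<Sum>(a, b)\<in>#M. {#(a \<otimes>\<^bsub>Q\<^esub> a', b \<otimes>\<^bsub>restrict_ring C\<^esub> b'). (a', b') \<in># N#})"
  have "tcl M \<otimes>\<^bsub>tprod\<^esub> tcl N = (\<Union>M'\<in>tcl M. \<Union>N'\<in>tcl N. tcl (?f M' N'))"
    by (simp only: tensor_product_def monoid.simps)
  also have "\<dots> = (\<Union>M'\<in>tcl M. tcl (?f M' N))"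
    using assms(1) tensor_class_eq[OF assms(1)]
    by (intro SUP_cong UN_tcl assms(2) mult_reps) (simp_all only: tensor_coords_mult mem_Collect_eq)
  also have "\<dots> = tcl (?f M N)"
    by (intro UN_tcl assms mult_reps) (simp_all only: tensor_coords_mult)
  finally show ?thesis .
qed

lemma tprod_add:
  assumes "M \<in> reps" "N \<in> reps"
  shows "tcl M \<oplus>\<^bsub>tprod\<^esub> tcl N = tcl (M + N)"
proof -
  have "tcl M \<oplus>\<^bsub>tprod\<^esub> tcl N = (\<Union>M'\<in>tcl M. \<Union>N'\<in>tcl N. tcl (M' + N'))"
    by (simp add: tensor_product_def)
  also have "\<dots> = (\<Union>M'\<in>tcl M. tcl (M' + N))"
    using assms tensor_class_eq[OF assms(1)]
    by (intro SUP_cong UN_tcl) auto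
  also have "\<dots> = tcl (M + N)"
    using assms by (intro UN_tcl) auto
  finally show ?thesis .
qed

lemma coords_iso:
  "coords \<in> ring_iso tprod (quaternion_algebra (restrict_ring C) (\<iota> \<alpha>) (\<iota> \<beta>))"
proof -
  let ?R = "quaternion_algebra (restrict_ring C) (\<iota> \<alpha>) (\<iota> \<beta>)"
  note R = quaternion_algebra_simps[OF \<iota>_mem[of \<alpha>] \<iota>_mem[of \<beta>]]
  show ?thesis unfolding ring_iso_def
  proof (intro CollectI conjI ring_hom_memI)
    fix S assume "S \<in> carrier tprod"
    then obtain M where M: "M \<in> reps" "S = tcl M" by (auto simp: carrier_tprod)
    then show "coords S \<in> carrier ?R"
      by (simp add: coords_class R tensor_coords_mem del: mem_Sigma_iff)
    fix T assume "T \<in> carrier tprod"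
    then obtain N where N: "N \<in> reps" "T = tcl N" by (auto simp: carrier_tprod)
    show "coords (S \<otimes>\<^bsub>tprod\<^esub> T) = coords S \<otimes>\<^bsub>?R\<^esub> coords T"
      unfolding M N tprod_mult[OF M(1) N(1)] coords_class[OF mult_reps[OF M(1) N(1)]]
        coords_class[OF M(1)] coords_class[OF N(1)] tensor_coords_mult
      using M N by (simp add: R tensor_coords_mem del: mem_Sigma_iff)
    show "coords (S \<oplus>\<^bsub>tprod\<^esub> T) = coords S \<oplus>\<^bsub>?R\<^esub> coords T"
      using M N by (auto simp: tprod_add coords_class R)
  next
    show "coords \<one>\<^bsub>tprod\<^esub> = \<one>\<^bsub>?R\<^esub>"
      by (simp add: tensor_product_def coords_class one_mem R hom_simps)
    show "bij_betw coords (carrier tprod) (carrier ?R)"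
    proof (rule bij_betw_imageI)
      show "inj_on coords (carrier tprod)"
      proof (rule inj_onI)
        fix S T assume "S \<in> carrier tprod" "T \<in> carrier tprod" and eq: "coords S = coords T"
        then obtain M N where "M \<in> reps" "N \<in> reps" "S = tcl M" "T = tcl N"
          unfolding carrier_tprod by blast
        with eq show "S = T" by (simp only: tcl_eq_iff coords_class)
      qed
      have "coords ` carrier tprod = tensor_coords \<iota> ` reps"
        unfolding carrier_tprod image_image by (intro image_cong) (simp_all add: coords_class)
      also have "\<dots> = quats C"
      proof
        show "quats C \<subseteq> tensor_coords \<iota> ` reps"
          using normal_form_reps tensor_coords_normal_form by (metis (no_types, lifting) image_eqI subsetI)
      qed (use tensor_coords_mem in blast)
      finally show "coords ` carrier tprod = carrier ?R" by (simp only: R)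
    qed
  qed
qed

lemma coords_scalar: "l \<in> C \<Longrightarrow> coords (tcl {#(\<one>\<^bsub>Q\<^esub>, l)#}) = (l, 0, 0, 0)"
  by (simp add: coords_class hom_simps)

text \<open>To recognise the coordinate version of \<open>d \<otimes> id + id \<otimes> E\<close> it suffices to compare values on pure tensors,
  since both sides are additive.\<close>

lemma coords_tensor_derivation:
  assumes d'_add: "\<And>x y. x \<in> quats C \<Longrightarrow> y \<in> quats C \<Longrightarrow> d' (x + y) = d' x + d' y"
    and d': "\<And>l q. l \<in> C \<Longrightarrow> d' (qscale l (qmap \<iota> q)) = qscale l (qmap \<iota> (d q)) + qscale (E l) (qmap \<iota> q)"
    and t: "t \<in> carrier tprod"
  shows "coords (tensor_derivation K Q (quaternion_const K) (restrict_ring C) \<iota> d E t) = d' (coords t)"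
proof -
  let ?f = "\<lambda>M. (\<Sum>(a, b)\<in>#M. {#(d a, b), (a, E b)#})"
  have d'_zero: "d' 0 = 0" by (metis add_cancel_left_left add_0 d'_add quat_zero mem_Sigma_iff zero_mem)
  have co: "tensor_coords \<iota> (?f M) = d' (tensor_coords \<iota> M)" if "M \<in> reps" for M
    using that
  proof (induction M)
    case empty
    then show ?case by (simp add: d'_zero)
  next
    case (add p M)
    obtain q l where p: "p = (q, l)" by (cases p)
    have l: "l \<in> C" and M: "M \<in> reps" using add.prems by (auto simp: p)
    show ?case
      using add.IH[OF M] d'_add[OF qscale_mem[OF l qmap_mem[of q]] tensor_coords_mem[OF M]] d'[OF l, of q]
      by (simp add: p add_ac)
  qed
  have fr: "?f M \<in> reps" if "M \<in> reps" for M
    using that by (force simp: deriv_mem)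
  obtain M where M: "M \<in> reps" "t = tcl M" using t by (auto simp: carrier_tprod)
  have "tensor_derivation K Q (quaternion_const K) (restrict_ring C) \<iota> d E t = (\<Union>M'\<in>tcl M. tcl (?f M'))"
    by (simp only: tensor_derivation_def M)
  also have "\<dots> = tcl (?f M)"
    by (intro UN_tcl M fr) (simp_all only: co M(1))
  finally show ?thesis using M fr[OF M(1)] by (simp only: coords_class co)
qed

end

section \<open>Transcendence degree of extensions of k(x, y, z)\<close>

lemma (in differential_subfield) finprod_restrict_ring: "f \<in> A \<rightarrow> C \<Longrightarrow> finprod (restrict_ring C) f A = prod f A"
proof (induction A rule: infinite_finite_induct)
  interpret field "restrict_ring C" by (rule field_restrict_ring)
  {
    case (infinite A)
    then show ?case using finprod_infinite[of A f] by simp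
  next
    case empty
    then show ?case by simp
  next
    case (insert x F)
    then show ?case using finprod_insert[of F x f] by auto
  }
qed

lemma nat_pow_restrict_ring: "x [^]\<^bsub>restrict_ring C\<^esub> (n::nat) = x ^ n"
  by (induction n) (simp_all add: nat_pow_def mult.commute)

lemma (in differential_subfield) power_mem: "x \<in> C \<Longrightarrow> x ^ n \<in> C"
  by (induction n) (auto simp: mem)

lemma (in differential_subfield) monomial_value_restrict_ring:
  assumes "set_mset m \<subseteq> S" "finite S" "S \<subseteq> C"
  shows "monomial_value (restrict_ring C) m = (\<Prod>x\<in>S. x ^ count m x)"
proof -
  have "monomial_value (restrict_ring C) m = (\<Prod>x\<in>set_mset m. x ^ count m x)"
    unfolding monomial_value_def nat_pow_restrict_ring
    by (rule finprod_restrict_ring) (use assms power_mem in blast)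
  also have "\<dots> = (\<Prod>x\<in>S. x ^ count m x)"
    by (rule prod.mono_neutral_left) (use assms in \<open>auto simp: not_in_iff\<close>)
  finally show ?thesis .
qed

lemma monomial3:
  fixes c :: "'k::idom"
  shows "[:[:[:c:]:]:] * ([:[:[:0, 1:]:]:] ^ i * [:[:0, 1:]:] ^ j * [:0, 1:] ^ k) = monom (monom (monom c i) j) k"
proof -
  have 1: "[:p:] ^ n = [:p ^ n:]" for p :: "'b::idom" and n
    by (induction n) (simp_all add: one_pCons)
  have 2: "[:0, 1:] ^ n = (monom 1 n :: 'b::idom poly)" for n
    by (simp add: monom_altdef)
  have "[:0, 1:] ^ k = (monom [:[:1:]:] k :: 'k poly poly poly)"
    unfolding 2 by (simp add: one_pCons)
  then show ?thesis unfolding 1 2 by (simp add: smult_monom mult.commute)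
qed

lemma hom_sum: "unital_hom e \<Longrightarrow> e (\<Sum>x\<in>A. f x) = (\<Sum>x\<in>A. e (f x))"
  by (induction A rule: infinite_finite_induct) (auto simp: unital_hom_zero unital_hom_def)

lemma hom_power: "unital_hom e \<Longrightarrow> e (x ^ n) = e x ^ n"
  by (induction n) (auto simp: unital_hom_def)

text \<open>The polynomial ring \<open>k[x, y, z]\<close> is embedded in the field \<open>C\<close> by \<open>e\<close>, with \<open>x\<close> as the innermost and \<open>z\<close> as the
  outermost variable.\<close>

locale rational_functions3 = differential_subfield C E for C :: "'a::field set" and E +
  fixes e :: "'k::field poly poly poly \<Rightarrow> 'a"
  assumes hom: "unital_hom e" and inj: "\<And>p. e p = 0 \<Longrightarrow> p = 0" and e_mem: "e p \<in> C"
begin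

definition "x = e [:[:[:0, 1:]:]:]"
definition "y = e [:[:0, 1:]:]"
definition "z = e [:0, 1:]"

lemma e_eq_iff: "e p = e q \<longleftrightarrow> p = q"
proof
  assume "e p = e q"
  then have "e (p - q) = 0" by (simp add: unital_hom_simps[OF hom])
  then show "p = q" using inj by fastforce
qed simp

lemma xyz_distinct: "x \<noteq> y" "x \<noteq> z" "y \<noteq> z"
  by (simp_all add: x_def y_def z_def e_eq_iff)

text \<open>A vanishing combination of monomials is the image of a polynomial under the injective map \<open>e\<close>, so that
  polynomial is zero, and the coefficients can be read off because a multiset over \<open>{x, y, z}\<close> is
  determined by three multiplicities.\<close>

lemma algebraically_independent_xyz:
  "algebraically_independent (restrict_ring C) (range (\<lambda>c. e [:[:[:c:]:]:])) {x, y, z}"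
  unfolding algebraically_independent_def
proof (intro allI impI ballI)
  fix M c m0
  assume M: "finite M" "\<forall>m\<in>M. set_mset m \<subseteq> {x, y, z}" "c \<in> M \<rightarrow> range (\<lambda>c. e [:[:[:c:]:]:])"
    and sum0: "(\<Oplus>\<^bsub>restrict_ring C\<^esub>m\<in>M. c m \<otimes>\<^bsub>restrict_ring C\<^esub> monomial_value (restrict_ring C) m) = \<zero>\<^bsub>restrict_ring C\<^esub>"
    and m0: "m0 \<in> M"
  have "\<forall>m\<in>M. \<exists>g. c m = e [:[:[:g:]:]:]" using M(3) by fastforce
  then obtain g where g: "\<And>m. m \<in> M \<Longrightarrow> c m = e [:[:[:g m:]:]:]" by metis
  have xyz: "{x, y, z} \<subseteq> C" by (simp add: x_def y_def z_def e_mem)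
  define mon where "mon m = monom (monom (monom (g m) (count m x)) (count m y)) (count m z)" for m
  have emult: "e (u * v) = e u * e v" for u v using hom by (simp add: unital_hom_def)
  have summand: "c m \<otimes>\<^bsub>restrict_ring C\<^esub> monomial_value (restrict_ring C) m = e (mon m)" if "m \<in> M" for m
  proof -
    have "monomial_value (restrict_ring C) m = x ^ count m x * y ^ count m y * z ^ count m z"
      using M(2) that xyz_distinct
      by (subst monomial_value_restrict_ring[OF _ _ xyz]) (auto simp: mult.assoc)
    then show ?thesis
      unfolding mon_def monomial3[symmetric] g[OF that]
      by (simp only: restrict_ring_simps emult hom_power[OF hom] flip: x_def y_def z_def)
  qed
  have "(\<Oplus>\<^bsub>restrict_ring C\<^esub>m\<in>M. c m \<otimes>\<^bsub>restrict_ring C\<^esub> monomial_value (restrict_ring C) m) = (\<Sum>m\<in>M. e (mon m))"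
    by (subst finsum_restrict_ring, rule Pi_I, subst summand, assumption, rule e_mem)
      (rule sum.cong[OF HOL.refl summand])
  then have "e (\<Sum>m\<in>M. mon m) = 0" using sum0 by (simp add: hom_sum[OF hom])
  then have "(\<Sum>m\<in>M. mon m) = 0" by (rule inj)
  then have "0 = coeff (coeff (coeff (\<Sum>m\<in>M. mon m) (count m0 z)) (count m0 y)) (count m0 x)" by simp
  also have "\<dots> = (\<Sum>m\<in>M. if m = m0 then g m else 0)"
    unfolding coeff_sum
  proof (rule sum.cong[OF HOL.refl])
    fix m assume m: "m \<in> M"
    have "m = m0" if "count m x = count m0 x" "count m y = count m0 y" "count m z = count m0 z"
    proof (rule multiset_eqI)
      fix w
      show "count m w = count m0 w"
      proof (cases "w \<in> {x, y, z}")
        case False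
        then have "w \<notin># m" "w \<notin># m0" using M(2) m m0 by auto
        then show ?thesis by (simp add: not_in_iff)
      qed (use that in auto)
    qed
    then show "coeff (coeff (coeff (mon m) (count m0 z)) (count m0 y)) (count m0 x) = (if m = m0 then g m else 0)"
      by (auto simp: mon_def)
  qed
  also have "\<dots> = g m0" using M(1) m0 by simp
  finally show "c m0 = \<zero>\<^bsub>restrict_ring C\<^esub>"
    using g[OF m0] unital_hom_zero[OF hom] by simp
qed

abbreviation "gen \<equiv> generate_field (restrict_ring C) (range (\<lambda>c. e [:[:[:c:]:]:]) \<union> {x, y, z})"

lemma gen_incl: "range (\<lambda>c. e [:[:[:c:]:]:]) \<union> {x, y, z} \<subseteq> carrier (restrict_ring C)"
  by (auto simp: x_def y_def z_def e_mem)

lemma gen_closed: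
  "u \<in> gen \<Longrightarrow> v \<in> gen \<Longrightarrow> u + v \<in> gen" "u \<in> gen \<Longrightarrow> v \<in> gen \<Longrightarrow> u * v \<in> gen" "0 \<in> gen"
  using generate_field.eng_add[of u "restrict_ring C" _ v] generate_field.eng_mult[of u "restrict_ring C" _ v]
    field.zero_in_generate[OF field_restrict_ring, of "range (\<lambda>c. e [:[:[:c:]:]:]) \<union> {x, y, z}"]
  by auto

lemma e_mem_gen: "e p \<in> gen"
proof -
  have xyz: "x \<in> gen" "y \<in> gen" "z \<in> gen" by (auto intro: generate_field.incl)
  have c: "e [:[:[:c:]:]:] \<in> gen" for c by (rule generate_field.incl) blast
  have h: "e (u + v) = e u + e v" "e (u * v) = e u * e v" for u v
    using hom by (auto simp: unital_hom_def)
  have 1: "e [:[:p:]:] \<in> gen" for p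
  proof (induction p)
    case 0 then show ?case using gen_closed(3) unital_hom_zero[OF hom] by simp
  next
    case (pCons a p)
    have "[:[:pCons a p:]:] = [:[:[:a:]:]:] + [:[:[:0, 1:]:]:] * [:[:p:]:]" by simp
    then show ?case using pCons.IH c xyz gen_closed(1,2) by (simp only: h flip: x_def)
  qed
  have 2: "e [:p:] \<in> gen" for p
  proof (induction p)
    case 0 then show ?case using gen_closed(3) unital_hom_zero[OF hom] by simp
  next
    case (pCons a p)
    have "[:pCons a p:] = [:[:a:]:] + [:[:0, 1:]:] * [:p:]" by simp
    then show ?case using pCons.IH 1 xyz gen_closed(1,2) by (simp only: h flip: y_def)
  qed
  show ?thesis
  proof (induction p)
    case 0 then show ?case using gen_closed(3) unital_hom_zero[OF hom] by simp
  next
    case (pCons a p)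
    have "pCons a p = [:a:] + [:0, 1:] * p" by simp
    then show ?case using pCons.IH 2 xyz gen_closed(1,2) by (simp only: h flip: z_def)
  qed
qed

lemma quotient_mem_gen: "q \<noteq> 0 \<Longrightarrow> e p / e q \<in> gen"
proof -
  assume "q \<noteq> 0"
  interpret L: field "restrict_ring C" by (rule field_restrict_ring)
  have nz: "e q \<noteq> 0" using inj \<open>q \<noteq> 0\<close> by blast
  have "inv\<^bsub>restrict_ring C\<^esub> (e q) = inverse (e q)"
    using nz inverse_mem[OF e_mem] by (intro L.comm_inv_char) (simp_all add: e_mem)
  moreover have "inv\<^bsub>restrict_ring C\<^esub> (e q) \<in> gen"
    by (rule generate_field.m_inv[OF e_mem_gen]) (simp add: nz)
  ultimately show ?thesis using gen_closed(2)[OF e_mem_gen] by (simp add: divide_inverse)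
qed

text \<open>These elements form a subfield, so it suffices to exhibit generators of \<open>C\<close> among them in order to see
  that \<open>x\<close>, \<open>y\<close>, \<open>z\<close> is a transcendence basis.\<close>

definition algebraics :: "'a set" where
  "algebraics = {w \<in> carrier (restrict_ring C). ring.algebraic (restrict_ring C) gen w}"

lemma subfield_algebraics: "subfield algebraics (restrict_ring C)"
  using field.subfield_of_algebraics[OF field_restrict_ring
      field.generate_field_is_subfield[OF field_restrict_ring gen_incl]]
  by (simp add: algebraics_def over_def)

lemma algebraics_closed:
  "u \<in> algebraics \<Longrightarrow> v \<in> algebraics \<Longrightarrow> u + v \<in> algebraics"
  "u \<in> algebraics \<Longrightarrow> v \<in> algebraics \<Longrightarrow> u * v \<in> algebraics"
  using subringE(6,7)[OF subfieldE(1)[OF subfield_algebraics]] by auto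

lemma gen_subset_algebraics: "gen \<subseteq> algebraics"
proof
  interpret L: field "restrict_ring C" by (rule field_restrict_ring)
  fix w assume w: "w \<in> gen"
  then show "w \<in> algebraics"
    using L.algebraic_self[OF subfieldE(1)[OF L.generate_field_is_subfield[OF gen_incl]] w]
      L.generate_field_in_carrier[OF gen_incl w]
    by (simp add: algebraics_def over_def)
qed

lemma sqrt_mem_algebraics:
  assumes "s \<in> C" "s\<^sup>2 \<in> gen"
  shows "s \<in> algebraics"
proof -
  interpret L: field "restrict_ring C" by (rule field_restrict_ring)
  have G: "subring gen (restrict_ring C)"
    by (rule subfieldE(1)[OF L.generate_field_is_subfield[OF gen_incl]])
  have m: "\<ominus>\<^bsub>restrict_ring C\<^esub> (s\<^sup>2) = - (s\<^sup>2)"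
    by (rule L.minus_equality) (use assms(1) in \<open>simp_all add: mem power_mem\<close>)
  have "- (s\<^sup>2) \<in> gen" using subringE(5)[OF G assms(2)] unfolding m .
  then have "[1, 0, - (s\<^sup>2)] \<in> carrier (univ_poly (restrict_ring C) gen)"
    using subringE(2,3)[OF G] by (simp add: univ_poly_def polynomial_def)
  moreover have "L.eval [1, 0, - (s\<^sup>2)] s = \<zero>\<^bsub>restrict_ring C\<^esub>"
    by (simp add: nat_pow_restrict_ring) (simp add: power2_eq_square)
  ultimately have "ring.algebraic (restrict_ring C) gen s"
    using L.algebraicI[of "[1, 0, - (s\<^sup>2)]" gen s] by (simp only: over_def) blast
  then show ?thesis using assms(1) by (simp add: algebraics_def)
qed

lemma transcendence_degree_le_3:
  assumes "C \<subseteq> algebraics"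
  shows "transcendence_degree_le (restrict_ring C) (range (\<lambda>c. e [:[:[:c:]:]:])) 3"
  unfolding transcendence_degree_le_def transcendence_basis_def
proof (intro exI[of _ "{x, y, z}"] conjI ballI)
  show "card {x, y, z} \<le> 3" by (simp add: card_insert_if)
qed (use gen_incl algebraically_independent_xyz assms in \<open>auto simp: algebraics_def\<close>)

end

section \<open>Derivations of a quaternion algebra\<close>

text \<open>Derivations that extend \<open>D\<close> differ from the standard one by an inner derivation. Differentiating
  \<open>u\<^sup>2 = a\<close>, \<open>v\<^sup>2 = b\<close> and \<open>uv + vu = 0\<close> leaves exactly three free parameters in the coordinates of
  \<open>d u\<close> and \<open>d v\<close>, which are matched by the three coordinates of a pure quaternion \<open>\<theta>\<close>: by
  \<open>[\<theta>, u] = -2 a t3 v - 2 t2 uv\<close> and \<open>[\<theta>, v] = 2 b t3 u + 2 t1 uv\<close>.\<close>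

lemma quaternion_derivation_form:
  fixes a b :: "'k::field" and d :: "'k quat \<Rightarrow> 'k quat"
  assumes two: "(2::'k) \<noteq> 0" and a: "a \<noteq> 0" and b: "b \<noteq> 0"
    and add: "\<And>x y. d (x + y) = d x + d y"
    and mult: "\<And>x y. d (qmul a b x y) = qmul a b x (d y) + qmul a b (d x) y"
    and const: "\<And>c. d (c, 0, 0, 0) = (D c, 0, 0, 0)"
  obtains t1 t2 t3 where
    "\<And>x. d x = qderiv D (D a / (2 * a)) (D b / (2 * b)) x
      + qmul a b (0, t1, t2, t3) x - qmul a b x (0, t1, t2, t3)"
proof -
  obtain p0 p1 p2 p3 where p: "d (0, 1, 0, 0) = (p0, p1, p2, p3)" by (cases "d (0, 1, 0, 0)")
  obtain q0 q1 q2 q3 where q: "d (0, 0, 1, 0) = (q0, q1, q2, q3)" by (cases "d (0, 0, 1, 0)")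
  \<comment> \<open>the scalar and \<open>u\<close>-coordinates of the derivative of \<open>u\<^sup>2 = a\<close>, then likewise for \<open>v\<^sup>2 = b\<close>\<close>
  have uu: "2 * (a * p1) = D a" "2 * p0 = 0"
    using mult[of "(0, 1, 0, 0)" "(0, 1, 0, 0)"] const[of a] p by (simp_all add: algebra_simps)
  have vv: "2 * (b * q2) = D b" "2 * q0 = 0"
    using mult[of "(0, 0, 1, 0)" "(0, 0, 1, 0)"] const[of b] q by (simp_all add: algebra_simps)
  have "d 0 = 0" by (metis add add_0 add_cancel_left_left)
  have "(0, 0, 0, -1) + (0, 0, 0, 1) = (0 :: 'k quat)" by (simp add: quat_zero)
  then have "d (qmul a b (0, 0, 1, 0) (0, 1, 0, 0)) + d (qmul a b (0, 1, 0, 0) (0, 0, 1, 0)) = 0"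
    by (simp add: \<open>d 0 = 0\<close> flip: add)
  \<comment> \<open>the scalar coordinate of the derivative of \<open>vu + uv = 0\<close>\<close>
  then have uv: "2 * (a * q1 + b * p2) = 0"
    unfolding mult p q by (simp add: quat_zero algebra_simps)
  define t1 t2 t3 where "t1 = q3 / 2" and "t2 = - p3 / 2" and "t3 = - p2 / (2 * a)"
  define c1 c2 where "c1 = D a / (2 * a)" and "c2 = D b / (2 * b)"
  have "a * q1 + b * p2 = 0" using uv two by (metis mult_eq_0_iff)
  then have "a * q1 = - (b * p2)" by (simp only: add_eq_0_iff2)
  then have q1: "q1 = 2 * b * t3" using a two by (simp add: t3_def field_simps)
  have p': "p0 = 0" "p1 = c1" "p2 = - 2 * a * t3" "p3 = - 2 * t2"
    using uu two a by (auto simp: c1_def t2_def t3_def simp flip: uu(1))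
  have q': "q0 = 0" "q1 = 2 * b * t3" "q2 = c2" "q3 = 2 * t1"
    using vv two b q1 by (auto simp: c2_def t1_def simp flip: vv(1))
  show ?thesis
  proof
    fix x :: "'k quat"
    obtain x0 x1 x2 x3 where x: "x = (x0, x1, x2, x3)" by (cases x)
    have "d x = d ((x0, 0, 0, 0) + qmul a b (x1, 0, 0, 0) (0, 1, 0, 0) + qmul a b (x2, 0, 0, 0) (0, 0, 1, 0)
      + qmul a b (x3, 0, 0, 0) (qmul a b (0, 1, 0, 0) (0, 0, 1, 0)))"
      by (simp add: x)
    also have "\<dots> = qderiv D c1 c2 x + qmul a b (0, t1, t2, t3) x - qmul a b x (0, t1, t2, t3)"
      unfolding add mult const p q p' q' x by (simp add: algebra_simps)
    finally show "d x = qderiv D (D a / (2 * a)) (D b / (2 * b)) x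
      + qmul a b (0, t1, t2, t3) x - qmul a b x (0, t1, t2, t3)"
      by (simp only: c1_def c2_def)
  qed
qed

section \<open>The splitting field\<close>

lemma qmap_qderiv:
  assumes "unital_hom \<iota>" "\<And>c. E (\<iota> c) = \<iota> (D c)"
  shows "qmap \<iota> (qderiv D c1 c2 q) = qderiv E (\<iota> c1) (\<iota> c2) (qmap \<iota> q)"
  by (cases q) (simp add: assms(2) unital_hom_simps[OF assms(1)])

lemma (in differential_subfield) qderiv_qscale:
  "l \<in> C \<Longrightarrow> x \<in> quats C \<Longrightarrow> qderiv E c1 c2 (qscale l x) = qscale l (qderiv E c1 c2 x) + qscale (E l) x"
  by (cases x) (auto simp: deriv algebra_simps)

text \<open>The splitting isomorphism is the composition of \<open>(\<alpha>, \<beta>)\<^sub>k \<otimes> L \<cong> (\<alpha>, \<beta>)\<^sub>L\<close>, conjugation by \<open>F\<close>, which turns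
  \<open>d\<close> into the standard derivation, and the matrix representation, which turns the standard
  derivation into the coordinatewise one.\<close>

lemma split_by_conjugation:
  fixes C :: "'a::field set" and \<iota> :: "'k::field \<Rightarrow> 'a" and d :: "'k quat \<Rightarrow> 'k quat"
  assumes sub: "differential_subfield C E"
    and two: "(2::'a) \<noteq> 0"
    and hom: "unital_hom \<iota>" and \<iota>C: "\<And>c. \<iota> c \<in> C" and E\<iota>: "\<And>c. E (\<iota> c) = \<iota> (D c)"
    and s: "s \<in> C" "s \<noteq> 0" "s\<^sup>2 = \<iota> \<alpha>" "E s = \<iota> c1 * s"
    and r: "r \<in> C" "r \<noteq> 0" "r\<^sup>2 = \<iota> \<beta>" "E r = \<iota> c2 * r"
    and d: "\<And>q. d q = qderiv D c1 c2 q + qmul \<alpha> \<beta> \<theta> q - qmul \<alpha> \<beta> q \<theta>"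
    and F: "F \<in> quats C" and G: "G \<in> quats C"
    and FG: "qmul (\<iota> \<alpha>) (\<iota> \<beta>) F G = qone" "qmul (\<iota> \<alpha>) (\<iota> \<beta>) G F = qone"
    and dF: "qderiv E (\<iota> c1) (\<iota> c2) F = qmul (\<iota> \<alpha>) (\<iota> \<beta>) F (qmap \<iota> \<theta>) + qscale l F"
  shows "split_by ring_of_type_algebra (quaternion_algebra ring_of_type_algebra \<alpha> \<beta>)
    (quaternion_const ring_of_type_algebra) d (restrict_ring C) \<iota> E"
proof -
  interpret differential_subfield C E by fact
  interpret T: quaternion_tensor C E \<iota> \<alpha> \<beta>
    by unfold_locales (use hom \<iota>C in auto)
  have Es: "E (w\<^sup>2) = 2 * c * w\<^sup>2" if "w \<in> C" "E w = c * w" for w c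
    using that by (simp add: power2_eq_square deriv_mult algebra_simps)
  interpret B: quaternion_derivation C E "\<iota> \<alpha>" "\<iota> \<beta>" "\<iota> c1" "\<iota> c2"
    by unfold_locales (use \<iota>C Es[OF s(1,4)] Es[OF r(1,4)] s(3) r(3) in auto)
  let ?m = "qmul (\<iota> \<alpha>) (\<iota> \<beta>)" and ?\<theta> = "qmap \<iota> \<theta>"
  \<comment> \<open>the derivation \<open>d \<otimes> id + id \<otimes> E\<close> in coordinates\<close>
  define d' where "d' x = qderiv E (\<iota> c1) (\<iota> c2) x + ?m ?\<theta> x - ?m x ?\<theta>" for x
  have d'_add: "d' (x + y) = d' x + d' y" if "x \<in> quats C" "y \<in> quats C" for x y
    using that by (simp add: d'_def B.qderiv_add qmul_add_left qmul_add_right)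
  have qmap_diff: "qmap \<iota> (x - y) = qmap \<iota> x - qmap \<iota> y" for x y
    by (cases x; cases y) (simp add: unital_hom_simps[OF hom])
  have qscale_diff: "qscale l (x - y) = qscale l x - qscale l y" for l and x y :: "'a quat"
    by (cases x; cases y) (simp add: algebra_simps)
  have d'_pure: "d' (qscale l (qmap \<iota> q)) = qscale l (qmap \<iota> (d q)) + qscale (E l) (qmap \<iota> q)"
    if "l \<in> C" for l q
    by (simp add: d'_def d qmap_diff T.qmap_add T.qmap_qmul qmap_qderiv[where E = E and D = D, OF hom E\<iota>]
        qderiv_qscale[OF that T.qmap_mem] qmul_scale_left qmul_scale_right qscale_add qscale_diff)
  let ?\<psi> = "\<lambda>x. ?m (?m F x) G"
  let ?\<phi> = "quat_matrix s r \<circ> (?\<psi> \<circ> T.coords)"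
  have iso: "?\<phi> \<in> ring_iso T.tprod (matrix_ring 2 (restrict_ring C))"
    using quat_matrix_iso[OF two s(1,2) r(1,2)] unfolding s(3) r(3)
    by (intro ring_iso_set_trans[OF ring_iso_set_trans[OF T.coords_iso conjugation_iso[OF \<iota>C \<iota>C F G FG]]])
  have lin: "?\<phi> (T.tcl {#(\<one>\<^bsub>T.Q\<^esub>, l)#}) = scalar_matrix 2 (restrict_ring C) l" if "l \<in> C" for l
  proof -
    have "(l, 0, 0, 0) = qscale l qone" by simp
    then have "?\<psi> (l, 0, 0, 0) = (l, 0, 0, 0)"
      by (simp only: qmul_scale_left qmul_scale_right qmul_one FG)
    then show ?thesis by (simp add: T.coords_scalar[OF that, simplified] quat_matrix_scalar del: quat_matrix.simps)
  qed
  have der: "?\<phi> (tensor_derivation T.K T.Q (quaternion_const T.K) (restrict_ring C) \<iota> d E t) = matrix_derivation 2 E (?\<phi> t)"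
    if t: "t \<in> carrier T.tprod" for t
  proof -
    have "T.coords t \<in> carrier (quaternion_algebra (restrict_ring C) (\<iota> \<alpha>) (\<iota> \<beta>))"
      using T.coords_iso t unfolding ring_iso_def ring_hom_def by blast
    then have x: "T.coords t \<in> quats C" by (simp only: quaternion_algebra_simps[OF \<iota>C \<iota>C])
    have "?\<psi> (T.coords t) \<in> quats C" by (intro qmul_mem \<iota>C F G x)
    then have "matrix_derivation 2 E (?\<phi> t) = quat_matrix s r (qderiv E (\<iota> c1) (\<iota> c2) (?\<psi> (T.coords t)))"
      using quat_matrix_deriv[OF s(1,4) r(1,4)] by simp
    also have "\<dots> = quat_matrix s r (?\<psi> (d' (T.coords t)))"
      unfolding B.qderiv_conjugate[OF FG F G x dF] d'_def ..
    also have "d' (T.coords t) = T.coords (tensor_derivation T.K T.Q (quaternion_const T.K) (restrict_ring C) \<iota> d E t)"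
      by (rule T.coords_tensor_derivation[OF d'_add d'_pure t, symmetric])
    finally show ?thesis by simp
  qed
  show ?thesis unfolding split_by_def
    by (intro exI[of _ ?\<phi>] conjI ballI iso lin der) simp_all
qed

theorem theorem4p3:
  fixes D :: "'k::field \<Rightarrow> 'k"
    and \<alpha> \<beta> :: 'k
    and d :: "'k \<times> 'k \<times> 'k \<times> 'k \<Rightarrow> 'k \<times> 'k \<times> 'k \<times> 'k"
  assumes "CHAR('k) \<noteq> 2"
    and "differential_field (ring_of_type_algebra :: 'k ring) D"
    and "\<alpha> \<noteq> 0" and "\<beta> \<noteq> 0"
    and "derivation (quaternion_algebra ring_of_type_algebra \<alpha> \<beta>) d"
    and "\<forall>a. d (quaternion_const ring_of_type_algebra a) =
              quaternion_const ring_of_type_algebra (D a)"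
  shows "\<exists>(L :: 'k poly poly poly fract alg_closure ring) \<iota> E.
           differential_field_extension (ring_of_type_algebra :: 'k ring) D L E \<iota> \<and>
           transcendence_degree_le L (range \<iota>) 3 \<and>
           split_by ring_of_type_algebra
             (quaternion_algebra ring_of_type_algebra \<alpha> \<beta>)
             (quaternion_const ring_of_type_algebra) d L \<iota> E"
proof -
  have two_k: "(2::'k) \<noteq> 0"
  proof
    assume "(2::'k) = 0"
    then have "CHAR('k) dvd 2" using of_nat_eq_0_iff_char_dvd[of 2, where 'a = 'k] by simp
    moreover have "CHAR('k) \<noteq> 1" using of_nat_CHAR[where 'a = 'k] by (metis of_nat_1 one_neq_zero)
    ultimately show False using assms(1) prime_nat_iff two_is_prime_nat by blast
  qed
  have D: "derivation_along id D"
    using assms(2) by (simp add: differential_field_def derivation_def derivation_along_def)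
  have d_add: "d (x + y) = d x + d y"
    and d_mult: "d (qmul \<alpha> \<beta> x y) = qmul \<alpha> \<beta> x (d y) + qmul \<alpha> \<beta> (d x) y" for x y
    using assms(5) by (simp_all add: derivation_def del: split_paired_All)
  have d_const: "d (c, 0, 0, 0) = (D c, 0, 0, 0)" for c
    using assms(6) by (simp add: quaternion_const_def)
  obtain \<theta>1 \<theta>2 \<theta>3 where d: "\<And>q. d q = qderiv D (D \<alpha> / (2 * \<alpha>)) (D \<beta> / (2 * \<beta>)) q
      + qmul \<alpha> \<beta> (0, \<theta>1, \<theta>2, \<theta>3) q - qmul \<alpha> \<beta> q (0, \<theta>1, \<theta>2, \<theta>3)"
    using quaternion_derivation_form[OF two_k assms(3,4) d_add d_mult d_const] by blast
  define c1 c2 where "c1 = D \<alpha> / (2 * \<alpha>)" and "c2 = D \<beta> / (2 * \<beta>)"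
  let ?X = "[:[:[:0, 1:]:]:] :: 'k poly poly poly" and ?Y = "[:[:0, 1:]:] :: 'k poly poly poly"
    and ?Z = "[:0, 1:] :: 'k poly poly poly"
  define \<kappa> where "\<kappa> c = [:[:[:c:]:]:]" for c :: 'k
  \<comment> \<open>With \<open>F = 1 + X u + Y v + Z uv\<close>, the equation \<open>d\<^sub>0 F = F \<theta> + \<mu> F\<close> reads as follows: its first
    coordinate, in which the left side vanishes, determines \<open>\<mu>\<close>, and the other three prescribe the
    derivatives \<open>g1\<close>, \<open>g2\<close>, \<open>g3\<close> of \<open>X\<close>, \<open>Y\<close>, \<open>Z\<close>. All of them are polynomials over \<open>k\<close>.\<close>
  define \<mu> where "\<mu> = - (\<kappa> \<alpha> * (?X * \<kappa> \<theta>1) + \<kappa> \<beta> * (?Y * \<kappa> \<theta>2) - \<kappa> \<alpha> * \<kappa> \<beta> * (?Z * \<kappa> \<theta>3))"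
  define g1 where "g1 = \<kappa> \<theta>1 + \<kappa> \<beta> * (?Z * \<kappa> \<theta>2) - \<kappa> \<beta> * (?Y * \<kappa> \<theta>3) + \<mu> * ?X - \<kappa> c1 * ?X"
  define g2 where "g2 = \<kappa> \<theta>2 + \<kappa> \<alpha> * (?X * \<kappa> \<theta>3) - \<kappa> \<alpha> * (?Z * \<kappa> \<theta>1) + \<mu> * ?Y - \<kappa> c2 * ?Y"
  define g3 where "g3 = \<kappa> \<theta>3 + ?X * \<kappa> \<theta>2 - ?Y * \<kappa> \<theta>1 + \<mu> * ?Z - (\<kappa> c1 + \<kappa> c2) * ?Z"
  \<comment> \<open>the norm of \<open>F\<close>, nonzero because it takes the value 1 at the origin\<close>
  define N where "N = 1 - \<kappa> \<alpha> * ?X\<^sup>2 - \<kappa> \<beta> * ?Y\<^sup>2 + \<kappa> \<alpha> * \<kappa> \<beta> * ?Z\<^sup>2"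
  obtain \<delta> where \<delta>: "derivation_along id \<delta>" "\<And>a. \<delta> (\<kappa> a) = \<kappa> (D a)" "\<delta> ?X = g1" "\<delta> ?Y = g2" "\<delta> ?Z = g3"
    unfolding \<kappa>_def using derivation_along_poly3[OF D] by metis
  have "poly (poly (poly N 0) 0) 0 = 1" by (simp add: N_def \<kappa>_def power2_eq_square)
  then have "N \<noteq> 0" by auto
  define e where "e p = to_ac (to_fract p)" for p :: "'k poly poly poly"
  have hom: "unital_hom e" by (simp add: unital_hom_def e_def)
  have inj: "p = 0" if "e p = 0" for p using that by (simp add: e_def)
  note es = unital_hom_simps[OF hom]
  define \<iota> where "\<iota> c = e (\<kappa> c)" for c
  have \<kappa>_hom: "unital_hom \<kappa>" by (simp add: unital_hom_def \<kappa>_def one_pCons)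
  have \<iota>_hom: "unital_hom \<iota>"
    unfolding unital_hom_def by (simp add: \<iota>_def es unital_hom_simps[OF \<kappa>_hom])
  note \<iota>s = unital_hom_simps[OF \<iota>_hom]
  have \<iota>0: "\<iota> c = 0 \<longleftrightarrow> c = 0" for c using inj[of "\<kappa> c"] \<iota>s(2) by (auto simp: \<iota>_def \<kappa>_def)
  have "\<iota> 2 = 2" using \<iota>s(3)[of 1 1] \<iota>s(1) by simp
  then have two: "(2 :: 'k poly poly poly fract alg_closure) \<noteq> 0" using \<iota>0[of 2] two_k by simp
  obtain E0 where E0: "differential_subfield {e p / e q |p q. q \<noteq> 0} E0" "\<And>p. E0 (e p) = e (\<delta> p)"
    using differential_subfield_fractions[OF hom inj \<delta>(1)] by blast
  define C0 where "C0 = {e p / e q |p q. q \<noteq> 0}"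
  interpret F0: differential_subfield C0 E0 using E0(1) by (simp only: C0_def)
  have e0: "e p \<in> C0" for p
    unfolding C0_def using es(1) by (intro CollectI exI[of _ p] exI[of _ 1]) simp
  have \<iota>C0: "\<iota> c \<in> C0" for c by (simp add: \<iota>_def e0)
  obtain s where s2: "s\<^sup>2 = \<iota> \<alpha>" using nth_root_exists[of 2 "\<iota> \<alpha>"] by auto
  obtain r where r2: "r\<^sup>2 = \<iota> \<beta>" using nth_root_exists[of 2 "\<iota> \<beta>"] by auto
  have s0: "s \<noteq> 0" and r0: "r \<noteq> 0" by (metis s2 r2 \<iota>0 assms(3,4) zero_power2)+
  define C1 where "C1 = {a + b * s |a b. a \<in> C0 \<and> b \<in> C0}"
  obtain E1 where E1: "differential_subfield C1 E1" "\<And>x. x \<in> C0 \<Longrightarrow> E1 x = E0 x"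
    using F0.adjoin_sqrt[OF two _ s0, folded C1_def, unfolded s2, OF \<iota>C0] by blast
  have C01: "x \<in> C1" if "x \<in> C0" for x
    unfolding C1_def using that F0.zero_mem by (intro CollectI exI[of _ x] exI[of _ 0]) simp
  interpret F1: differential_subfield C1 E1 by (rule E1(1))
  define C2 where "C2 = {a + b * r |a b. a \<in> C1 \<and> b \<in> C1}"
  obtain E where E: "differential_subfield C2 E" "\<And>x. x \<in> C1 \<Longrightarrow> E x = E1 x"
    using F1.adjoin_sqrt[OF two _ r0, folded C2_def, unfolded r2, OF C01[OF \<iota>C0]] by blast
  have C12: "x \<in> C2" if "x \<in> C1" for x
    unfolding C2_def using that F1.zero_mem by (intro CollectI exI[of _ x] exI[of _ 0]) simp
  interpret F2: differential_subfield C2 E by (rule E(1))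
  have e2: "e p \<in> C2" for p by (intro C12 C01 e0)
  have Ee: "E (e p) = e (\<delta> p)" for p using E(2)[OF C01] E1(2) E0(2) e0 by simp
  have sC: "s \<in> C2"
    unfolding C1_def by (rule C12) (use F0.zero_mem F0.one_mem in \<open>force simp: C1_def\<close>)
  have rC: "r \<in> C2"
    unfolding C2_def using F1.zero_mem F1.one_mem by force
  have \<iota>C: "\<iota> c \<in> C2" for c by (simp add: \<iota>_def e2)
  have E\<iota>: "E (\<iota> c) = \<iota> (D c)" for c by (simp add: \<iota>_def Ee \<delta>)
  \<comment> \<open>The derivative of a square root of \<open>\<iota> c\<close> is forced.\<close>
  have root: "E w = \<iota> (D c / (2 * c)) * w" if "w \<in> C2" "w\<^sup>2 = \<iota> c" "w \<noteq> 0" "c \<noteq> 0" for w c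
  proof -
    have "D c = 2 * (D c / (2 * c)) * c" using two_k that by simp
    then have "\<iota> (D c) = \<iota> (2 * (D c / (2 * c)) * c)" by (rule arg_cong)
    then have "\<iota> (D c) = 2 * \<iota> (D c / (2 * c)) * w\<^sup>2" by (simp only: \<iota>s \<open>\<iota> 2 = 2\<close> that)
    moreover have "\<iota> (D c) = 2 * w * E w"
      using F2.deriv_mult[OF that(1,1)] E\<iota>[of c] by (simp add: power2_eq_square mult.assoc flip: that(2))
    ultimately have "2 * w * E w = 2 * w * (\<iota> (D c / (2 * c)) * w)" by (simp add: power2_eq_square)
    then show ?thesis using two that by simp
  qed
  have Es: "E s = \<iota> c1 * s" and Er: "E r = \<iota> c2 * r"
    unfolding c1_def c2_def using root sC rC s2 r2 s0 r0 assms(3,4) by blast+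
  interpret T: rational_functions3 C2 E e
    by unfold_locales (use hom inj e2 in auto)
  have range: "range \<iota> = range (\<lambda>c. e [:[:[:c:]:]:])" by (simp add: \<iota>_def \<kappa>_def)
  have ext: "differential_field_extension (ring_of_type_algebra :: 'k ring) D (restrict_ring C2) E \<iota>"
    unfolding differential_field_extension_def
    using assms(2) F2.differential_field_restrict_ring
    by (auto simp: E\<iota> \<iota>C \<iota>s intro!: ring_hom_memI)
  have \<iota>_gen: "\<iota> c \<in> T.gen" for c unfolding \<iota>_def by (rule T.e_mem_gen)
  have sA: "s \<in> T.algebraics" and rA: "r \<in> T.algebraics"
    using T.sqrt_mem_algebraics[OF sC, unfolded s2, OF \<iota>_gen] T.sqrt_mem_algebraics[OF rC, unfolded r2, OF \<iota>_gen] .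
  have "C0 \<subseteq> T.algebraics"
    unfolding C0_def using T.quotient_mem_gen T.gen_subset_algebraics by blast
  then have "C1 \<subseteq> T.algebraics" unfolding C1_def using T.algebraics_closed sA by blast
  have "C2 \<subseteq> T.algebraics"
  proof
    fix w assume "w \<in> C2"
    then obtain a b where "a \<in> C1" "b \<in> C1" "w = a + b * r" unfolding C2_def by blast
    then show "w \<in> T.algebraics" using \<open>C1 \<subseteq> T.algebraics\<close> T.algebraics_closed rA by blast
  qed
  then have deg: "transcendence_degree_le (restrict_ring C2) (range \<iota>) 3"
    unfolding range by (rule T.transcendence_degree_le_3)
  define F where "F = (1 :: 'k poly poly poly fract alg_closure, e ?X, e ?Y, e ?Z)"
  define G where "G = qscale (1 / e N) (1, - e ?X, - e ?Y, - e ?Z)"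
  have esq: "e (p\<^sup>2) = (e p)\<^sup>2" for p by (simp add: power2_eq_square es)
  have N: "e N = 1\<^sup>2 - \<iota> \<alpha> * (e ?X)\<^sup>2 - \<iota> \<beta> * (e ?Y)\<^sup>2 + \<iota> \<alpha> * \<iota> \<beta> * (e ?Z)\<^sup>2"
    by (simp only: N_def es esq \<iota>_def power_one)
  have N0: "e N \<noteq> 0" using inj \<open>N \<noteq> 0\<close> by blast
  note FG = qmul_inverse[OF F_def N N0, folded G_def]
  have FC: "F \<in> quats C2" by (simp add: F_def F2.one_mem e2)
  have GC: "G \<in> quats C2" by (simp add: G_def F2.mem e2)
  have dF: "qderiv E (\<iota> c1) (\<iota> c2) F =
    qmul (\<iota> \<alpha>) (\<iota> \<beta>) F (qmap \<iota> (0, \<theta>1, \<theta>2, \<theta>3)) + qscale (e \<mu>) F"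
    unfolding F_def qderiv.simps Ee \<delta> g1_def g2_def g3_def qmap.simps qmul.simps qscale.simps add_Pair
      F2.deriv_one \<iota>s(2) \<mu>_def es \<iota>_def[symmetric] prod.inject
    by (intro conjI; Groebner_Basis.algebra)
  have "split_by ring_of_type_algebra (quaternion_algebra ring_of_type_algebra \<alpha> \<beta>)
    (quaternion_const ring_of_type_algebra) d (restrict_ring C2) \<iota> E"
    by (rule split_by_conjugation[OF E(1) two \<iota>_hom \<iota>C E\<iota> sC s0 s2 Es rC r0 r2 Er _ FC GC FG dF])
      (simp only: d c1_def c2_def)
  with ext deg show ?thesis by blast
qed

end
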